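(* The Margolis-Rhodes monoid $\operatorname{MR}(P_{14})$ of the path graph $P_{14}$ with 14 vertices has Krohn-Rhodes complexity $2$.
   Context: $P_n$ is the path graph with vertex set $\{1,\dots,n\}$ and edges $\{i,i+1\}$, $1\le i<n$. For a finite simple graph $\Gamma=(V,E)$, the simplices are the singletons $\{v\}$, $v\in V$, and the edges. $\operatorname{MR}(\Gamma)$ is the monoid of all partial functions $f:V\to V$ (acting on the right, composed left to right) such that for every simplex $\sigma$ the full preimage $\sigma f^{-1}$ is a simplex or empty. Krohn-Rhodes complexity: a finite semigroup $S$ divides $T$ ($S\prec T$) if $S$ is a homomorphic image of a subsemigroup of $T$. The wreath product of transformation semigroups $(X,S)\wr(Y,T)$ acts on $X\times Y$ with semigroup $S^Y\times T$ via $(x,y)(f,t)=(x(yf),yt)$; for abstract semigroups one uses the right action of $S$ on $S$ with an identity adjoined if necessary. A finite semigroup is aperiodic if all its subgroups are trivial. The complexity of a finite semigroup $S$ is the least $n\ge0$ such that $S\prec A_n\wr G_n\wr A_{n-1}\wr\cdots\wr G_1\wr A_0$ with each $G_i$ a finite group and each $A_i$ a finite aperiodic semigroup. *)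

theory Defs
  imports "HOL-Algebra.Group" "HOL-Library.FuncSet"
begin

section \<open>Semigroups with explicit carrier\<close>

record 'a sgrp = "'a partial_object" +
  sg_mult :: "'a \<Rightarrow> 'a \<Rightarrow> 'a" (infixl \<open>\<star>\<index>\<close> 70)

definition is_semigroup :: "'a sgrp \<Rightarrow> bool" where
  "is_semigroup S \<longleftrightarrow>
     carrier S \<noteq> {} \<and>
     (\<forall>x\<in>carrier S. \<forall>y\<in>carrier S. x \<star>\<^bsub>S\<^esub> y \<in> carrier S) \<and>
     (\<forall>x\<in>carrier S. \<forall>y\<in>carrier S. \<forall>z\<in>carrier S.
        (x \<star>\<^bsub>S\<^esub> y) \<star>\<^bsub>S\<^esub> z = x \<star>\<^bsub>S\<^esub> (y \<star>\<^bsub>S\<^esub> z))"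

definition is_identity :: "'a sgrp \<Rightarrow> 'a \<Rightarrow> bool" where
  "is_identity S e \<longleftrightarrow>
     e \<in> carrier S \<and> (\<forall>x\<in>carrier S. e \<star>\<^bsub>S\<^esub> x = x \<and> x \<star>\<^bsub>S\<^esub> e = x)"

definition is_group :: "'a sgrp \<Rightarrow> bool" where
  "is_group S \<longleftrightarrow> (\<exists>e. group \<lparr>carrier = carrier S, mult = sg_mult S, one = e\<rparr>)"

text \<open>A subgroup of a semigroup is a subset that is a group under the induced multiplication;
  its identity may be any idempotent of the semigroup.\<close>

definition is_aperiodic :: "'a sgrp \<Rightarrow> bool" where
  "is_aperiodic S \<longleftrightarrow>
     (\<forall>H. H \<subseteq> carrier S \<and> is_group (S\<lparr>carrier := H\<rparr>) \<longrightarrow> (\<exists>e. H = {e}))"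

definition is_subsemigroup :: "'a set \<Rightarrow> 'a sgrp \<Rightarrow> bool" where
  "is_subsemigroup U S \<longleftrightarrow> U \<subseteq> carrier S \<and> is_semigroup (S\<lparr>carrier := U\<rparr>)"

definition sg_divides :: "'a sgrp \<Rightarrow> 'b sgrp \<Rightarrow> bool" (infix \<open>\<prec>\<close> 50) where
  "S \<prec> T \<longleftrightarrow>
     (\<exists>U h. is_subsemigroup U T \<and> h ` U = carrier S \<and>
        (\<forall>x\<in>U. \<forall>y\<in>U. h (x \<star>\<^bsub>T\<^esub> y) = h x \<star>\<^bsub>S\<^esub> h y))"

section \<open>Transformation semigroups and wreath products\<close>

record ('x, 's) tsg =
  points :: "'x set"
  sem :: "'s sgrp"
  act :: "'x \<Rightarrow> 's \<Rightarrow> 'x"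

definition is_tsg :: "('x, 's) tsg \<Rightarrow> bool" where
  "is_tsg P \<longleftrightarrow>
     is_semigroup (sem P) \<and>
     (\<forall>x\<in>points P. \<forall>s\<in>carrier (sem P). act P x s \<in> points P) \<and>
     (\<forall>x\<in>points P. \<forall>s\<in>carrier (sem P). \<forall>t\<in>carrier (sem P).
        act P x (s \<star>\<^bsub>sem P\<^esub> t) = act P (act P x s) t) \<and>
     (\<forall>s\<in>carrier (sem P). \<forall>t\<in>carrier (sem P).
        (\<forall>x\<in>points P. act P x s = act P x t) \<longrightarrow> s = t)"

text \<open>The right action of \<open>S\<close> on itself with an identity adjoined if necessary:
  \<open>None\<close> is the adjoined identity, and it is a point only if \<open>S\<close> has no identity.\<close>

definition regular_tsg :: "'s sgrp \<Rightarrow> ('s option, 's) tsg" where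
  "regular_tsg S =
     \<lparr>points = Some ` carrier S \<union> (if \<exists>e. is_identity S e then {} else {None}),
      sem = S,
      act = (\<lambda>x s. case x of None \<Rightarrow> Some s | Some r \<Rightarrow> Some (r \<star>\<^bsub>S\<^esub> s))\<rparr>"

text \<open>The multiplication is the one for which \<open>(x, y) (f, t) = (x (y f), y t)\<close> is a right action.
  Functions on the points of \<open>Q\<close> are extensional, so that the semigroup really is
  \<open>S\<^sup>Y \<times> T\<close>.\<close>

definition wreath :: "('x, 's) tsg \<Rightarrow> ('y, 't) tsg \<Rightarrow> ('x \<times> 'y, ('y \<Rightarrow> 's) \<times> 't) tsg"
    (infixr \<open>\<wr>\<close> 70) where
  "P \<wr> Q =
     \<lparr>points = points P \<times> points Q,
      sem =
        \<lparr>carrier = (points Q \<rightarrow>\<^sub>E carrier (sem P)) \<times> carrier (sem Q),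
         sg_mult = (\<lambda>(f, t) (g, u).
           (\<lambda>y\<in>points Q. f y \<star>\<^bsub>sem P\<^esub> g (act Q y t), t \<star>\<^bsub>sem Q\<^esub> u))\<rparr>,
      act = (\<lambda>(x, y) (f, t). (act P x (f y), act Q y t))\<rparr>"

definition tsg_iso :: "('x, 's) tsg \<Rightarrow> ('y, 't) tsg \<Rightarrow> bool" where
  "tsg_iso P Q \<longleftrightarrow>
     (\<exists>\<phi> \<psi>. bij_betw \<phi> (points P) (points Q) \<and>
        bij_betw \<psi> (carrier (sem P)) (carrier (sem Q)) \<and>
        (\<forall>s\<in>carrier (sem P). \<forall>t\<in>carrier (sem P).
           \<psi> (s \<star>\<^bsub>sem P\<^esub> t) = \<psi> s \<star>\<^bsub>sem Q\<^esub> \<psi> t) \<and>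
        (\<forall>x\<in>points P. \<forall>s\<in>carrier (sem P). \<phi> (act P x s) = act Q (\<phi> x) (\<psi> s)))"

section \<open>Krohn-Rhodes complexity\<close>

text \<open>\<open>kr_product n T\<close>: \<open>T\<close> is a copy of some
  \<open>A\<^sub>n \<wr> G\<^sub>n \<wr> A\<^sub>n\<^sub>-\<^sub>1 \<wr> \<dots> \<wr> G\<^sub>1 \<wr> A\<^sub>0\<close>.
  The type of the wreath product changes with each factor, so at each stage the (finite)
  product is replaced by an isomorphic transformation semigroup on natural numbers. For the same
  reason there is no loss in taking the factors to be semigroups on natural numbers.\<close>

inductive kr_product :: "nat \<Rightarrow> (nat, nat) tsg \<Rightarrow> bool" where
  base: "\<lbrakk>is_semigroup (A :: nat sgrp); finite (carrier A); is_aperiodic A;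
          tsg_iso (regular_tsg A) T\<rbrakk>
         \<Longrightarrow> kr_product 0 T"
| step: "\<lbrakk>kr_product n T;
          is_group (G :: nat sgrp); finite (carrier G);
          is_semigroup (A :: nat sgrp); finite (carrier A); is_aperiodic A;
          tsg_iso (regular_tsg A \<wr> regular_tsg G \<wr> T) T'\<rbrakk>
         \<Longrightarrow> kr_product (Suc n) T'"

definition kr_complexity :: "'a sgrp \<Rightarrow> nat" where
  "kr_complexity S = (LEAST n. \<exists>T. kr_product n T \<and> S \<prec> sem T)"

section \<open>The Margolis-Rhodes monoid of a graph\<close>

text \<open>A graph is a pair of a vertex set and a set of edges, each edge being a two-element set
  of vertices.\<close>

type_synonym 'v graph = "'v set \<times> 'v set set"

definition is_finite_simple_graph :: "'v graph \<Rightarrow> bool" where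
  "is_finite_simple_graph \<Gamma> \<longleftrightarrow>
     finite (fst \<Gamma>) \<and> (\<forall>e\<in>snd \<Gamma>. e \<subseteq> fst \<Gamma> \<and> card e = 2)"

definition path_graph :: "nat \<Rightarrow> nat graph" where
  "path_graph n = ({1..n}, {{i, i + 1} | i. 1 \<le> i \<and> i < n})"

definition simplices :: "'v graph \<Rightarrow> 'v set set" where
  "simplices \<Gamma> = {{v} | v. v \<in> fst \<Gamma>} \<union> snd \<Gamma>"

definition preimage :: "('v \<rightharpoonup> 'v) \<Rightarrow> 'v set \<Rightarrow> 'v set" where
  "preimage f \<sigma> = {v. \<exists>w\<in>\<sigma>. f v = Some w}"

text \<open>Maps act on the right, so the product of \<open>f\<close> and \<open>g\<close> is \<open>f\<close> followed by \<open>g\<close>.\<close>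

definition MR :: "'v graph \<Rightarrow> ('v \<rightharpoonup> 'v) sgrp" where
  "MR \<Gamma> =
     \<lparr>carrier = {f. dom f \<subseteq> fst \<Gamma> \<and> ran f \<subseteq> fst \<Gamma> \<and>
                    (\<forall>\<sigma>\<in>simplices \<Gamma>. preimage f \<sigma> \<in> simplices \<Gamma> \<or> preimage f \<sigma> = {})},
      sg_mult = (\<lambda>f g. g \<circ>\<^sub>m f)\<rparr>"

section \<open>Well-formedness\<close>

lemma is_finite_simple_graph_path_graph: "is_finite_simple_graph (path_graph n)"
  unfolding is_finite_simple_graph_def path_graph_def by auto

lemma preimage_map_comp: "preimage (g \<circ>\<^sub>m f) \<sigma> = preimage f (preimage g \<sigma>)"
  unfolding preimage_def map_comp_def by (auto split: option.splits)

lemma is_identity_MR: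
  fixes \<Gamma> :: "'v graph"
  assumes "is_finite_simple_graph \<Gamma>"
  shows "is_identity (MR \<Gamma>) (\<lambda>v. if v \<in> fst \<Gamma> then Some v else None)"
proof -
  let ?i = "\<lambda>v. if v \<in> fst \<Gamma> then Some v else None"
  have "\<sigma> \<subseteq> fst \<Gamma>" if "\<sigma> \<in> simplices \<Gamma>" for \<sigma>
    using that assms unfolding simplices_def is_finite_simple_graph_def by auto
  then have "preimage ?i \<sigma> = \<sigma>" if "\<sigma> \<in> simplices \<Gamma>" for \<sigma>
    using that unfolding preimage_def by auto
  moreover have "f \<circ>\<^sub>m ?i = f" if d: "dom f \<subseteq> fst \<Gamma>" for f :: "'v \<rightharpoonup> 'v"
  proof
    fix v show "(f \<circ>\<^sub>m ?i) v = f v"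
    proof (cases "v \<in> fst \<Gamma>")
      case False
      with d have "v \<notin> dom f" by blast
      with False show ?thesis by (simp add: map_comp_def domIff)
    qed (simp add: map_comp_def)
  qed
  moreover have "?i \<circ>\<^sub>m f = f" if r: "ran f \<subseteq> fst \<Gamma>" for f :: "'v \<rightharpoonup> 'v"
  proof
    fix v show "(?i \<circ>\<^sub>m f) v = f v"
    proof (cases "f v")
      case (Some w)
      with r have "w \<in> fst \<Gamma>" by (auto intro: ranI)
      with Some show ?thesis by (simp add: map_comp_def)
    qed (simp add: map_comp_def)
  qed
  moreover have "dom ?i \<subseteq> fst \<Gamma>" "ran ?i \<subseteq> fst \<Gamma>"
    by (auto simp: dom_def ran_def split: if_splits)
  ultimately show ?thesis
    unfolding is_identity_def MR_def by simp
qed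

lemma is_semigroup_MR:
  assumes "is_finite_simple_graph \<Gamma>"
  shows "is_semigroup (MR \<Gamma>)"
proof -
  have "g \<circ>\<^sub>m f \<in> carrier (MR \<Gamma>)" if f: "f \<in> carrier (MR \<Gamma>)" and g: "g \<in> carrier (MR \<Gamma>)" for f g
  proof -
    have "dom (g \<circ>\<^sub>m f) \<subseteq> dom f" "ran (g \<circ>\<^sub>m f) \<subseteq> ran g"
      by (auto simp: map_comp_def dom_def ran_def split: option.splits)
    then have "dom (g \<circ>\<^sub>m f) \<subseteq> fst \<Gamma>" "ran (g \<circ>\<^sub>m f) \<subseteq> fst \<Gamma>"
      using f g by (auto simp: MR_def)
    moreover have "preimage (g \<circ>\<^sub>m f) \<sigma> \<in> simplices \<Gamma> \<or> preimage (g \<circ>\<^sub>m f) \<sigma> = {}"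
      if "\<sigma> \<in> simplices \<Gamma>" for \<sigma>
    proof (cases "preimage g \<sigma> = {}")
      case True
      then show ?thesis by (simp add: preimage_map_comp) (simp add: preimage_def)
    next
      case False
      with g that have "preimage g \<sigma> \<in> simplices \<Gamma>" by (auto simp: MR_def)
      with f show ?thesis by (simp add: preimage_map_comp MR_def)
    qed
    ultimately show ?thesis by (simp add: MR_def)
  qed
  moreover have "h \<circ>\<^sub>m (g \<circ>\<^sub>m f) = (h \<circ>\<^sub>m g) \<circ>\<^sub>m f" for f g h :: "'a \<rightharpoonup> 'a"
    by (rule ext) (simp add: map_comp_def split: option.split)
  moreover have "carrier (MR \<Gamma>) \<noteq> {}"
    using is_identity_MR[OF assms] unfolding is_identity_def by blast
  ultimately show ?thesis
    unfolding is_semigroup_def by (simp add: MR_def)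
qed

lemma is_tsg_regular:
  assumes "is_semigroup S"
  shows "is_tsg (regular_tsg S)"
proof -
  let ?P = "regular_tsg S"
  have act: "act ?P (Some r) s = Some (r \<star>\<^bsub>S\<^esub> s)" "act ?P None s = Some s" for r s
    by (simp_all add: regular_tsg_def)
  have sem: "sem ?P = S" by (simp add: regular_tsg_def)
  have pts: "Some r \<in> points ?P \<longleftrightarrow> r \<in> carrier S" for r
    by (auto simp: regular_tsg_def)
  have closed: "x \<star>\<^bsub>S\<^esub> y \<in> carrier S" if "x \<in> carrier S" "y \<in> carrier S" for x y
    using assms that unfolding is_semigroup_def by blast
  have assoc: "(x \<star>\<^bsub>S\<^esub> y) \<star>\<^bsub>S\<^esub> z = x \<star>\<^bsub>S\<^esub> (y \<star>\<^bsub>S\<^esub> z)"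
    if "x \<in> carrier S" "y \<in> carrier S" "z \<in> carrier S" for x y z
    using assms that unfolding is_semigroup_def by blast
  have 1: "act ?P x s \<in> points ?P" if "x \<in> points ?P" "s \<in> carrier S" for x s
    using that by (cases x) (simp_all add: act pts closed)
  have 2: "act ?P x (s \<star>\<^bsub>S\<^esub> t) = act ?P (act ?P x s) t"
    if "x \<in> points ?P" "s \<in> carrier S" "t \<in> carrier S" for x s t
    using that by (cases x) (simp_all add: act pts assoc)
  have 3: "s = t" if s: "s \<in> carrier S" and t: "t \<in> carrier S"
    and eq: "\<forall>x\<in>points ?P. act ?P x s = act ?P x t" for s t
  proof (cases "\<exists>e. is_identity S e")
    case True
    then obtain e where e: "is_identity S e" ..
    then have "e \<in> carrier S" by (simp add: is_identity_def)
    then have "act ?P (Some e) s = act ?P (Some e) t" using eq pts by blast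
    with e s t show ?thesis by (simp add: act is_identity_def)
  next
    case False
    then have "None \<in> points ?P" by (simp add: regular_tsg_def)
    then have "act ?P None s = act ?P None t" using eq by blast
    then show ?thesis by (simp add: act)
  qed
  show ?thesis
    unfolding is_tsg_def sem using assms 1 2 3 by blast
qed

lemma is_tsg_wreath:
  assumes P: "is_tsg P" and Q: "is_tsg Q" and ne: "points P \<noteq> {}"
  shows "is_tsg (P \<wr> Q)"
proof -
  let ?F = "points Q \<rightarrow>\<^sub>E carrier (sem P)"
  let ?W = "P \<wr> Q"
  let ?m = "\<lambda>f t g. \<lambda>y\<in>points Q. f y \<star>\<^bsub>sem P\<^esub> g (act Q y t)"
  have carr: "carrier (sem ?W) = ?F \<times> carrier (sem Q)"
    and pts: "points ?W = points P \<times> points Q"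
    and mult: "\<And>f t g u. (f, t) \<star>\<^bsub>sem ?W\<^esub> (g, u) = (?m f t g, t \<star>\<^bsub>sem Q\<^esub> u)"
    and act: "\<And>x y f t. act ?W (x, y) (f, t) = (act P x (f y), act Q y t)"
    by (simp_all add: wreath_def)
  have SP: "is_semigroup (sem P)" and SQ: "is_semigroup (sem Q)"
    using P Q by (simp_all add: is_tsg_def)
  have Pc: "x \<star>\<^bsub>sem P\<^esub> y \<in> carrier (sem P)"
    if "x \<in> carrier (sem P)" "y \<in> carrier (sem P)" for x y
    using SP that unfolding is_semigroup_def by blast
  have Qc: "x \<star>\<^bsub>sem Q\<^esub> y \<in> carrier (sem Q)"
    if "x \<in> carrier (sem Q)" "y \<in> carrier (sem Q)" for x y
    using SQ that unfolding is_semigroup_def by blast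
  have Pa: "(x \<star>\<^bsub>sem P\<^esub> y) \<star>\<^bsub>sem P\<^esub> z = x \<star>\<^bsub>sem P\<^esub> (y \<star>\<^bsub>sem P\<^esub> z)"
    if "x \<in> carrier (sem P)" "y \<in> carrier (sem P)" "z \<in> carrier (sem P)" for x y z
    using SP that unfolding is_semigroup_def by blast
  have Qa: "(x \<star>\<^bsub>sem Q\<^esub> y) \<star>\<^bsub>sem Q\<^esub> z = x \<star>\<^bsub>sem Q\<^esub> (y \<star>\<^bsub>sem Q\<^esub> z)"
    if "x \<in> carrier (sem Q)" "y \<in> carrier (sem Q)" "z \<in> carrier (sem Q)" for x y z
    using SQ that unfolding is_semigroup_def by blast
  have Pp: "act P x s \<in> points P" if "x \<in> points P" "s \<in> carrier (sem P)" for x s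
    using P that unfolding is_tsg_def by blast
  have Qp: "act Q x s \<in> points Q" if "x \<in> points Q" "s \<in> carrier (sem Q)" for x s
    using Q that unfolding is_tsg_def by blast
  have Pact: "act P x (s \<star>\<^bsub>sem P\<^esub> t) = act P (act P x s) t"
    if "x \<in> points P" "s \<in> carrier (sem P)" "t \<in> carrier (sem P)" for x s t
    using P that unfolding is_tsg_def by blast
  have Qact: "act Q x (s \<star>\<^bsub>sem Q\<^esub> t) = act Q (act Q x s) t"
    if "x \<in> points Q" "s \<in> carrier (sem Q)" "t \<in> carrier (sem Q)" for x s t
    using Q that unfolding is_tsg_def by blast
  have F: "f y \<in> carrier (sem P)" if "f \<in> ?F" "y \<in> points Q" for f y
    using that by (rule PiE_mem)
  have mF: "?m f t g \<in> ?F" if "f \<in> ?F" "g \<in> ?F" "t \<in> carrier (sem Q)" for f t g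
  proof (rule restrict_PiE_iff[THEN iffD2], rule ballI)
    fix y assume "y \<in> points Q"
    then show "f y \<star>\<^bsub>sem P\<^esub> g (act Q y t) \<in> carrier (sem P)"
      by (intro Pc F that Qp)
  qed
  have ne': "carrier (sem ?W) \<noteq> {}"
    using SP SQ unfolding carr is_semigroup_def by (simp add: PiE_eq_empty_iff)
  have closed: "p \<star>\<^bsub>sem ?W\<^esub> q \<in> carrier (sem ?W)"
    if p: "p \<in> carrier (sem ?W)" and q: "q \<in> carrier (sem ?W)" for p q
  proof -
    obtain f t g u where pq: "p = (f, t)" "q = (g, u)" by (cases p, cases q)
    from p q have "f \<in> ?F" "g \<in> ?F" "t \<in> carrier (sem Q)" "u \<in> carrier (sem Q)"
      unfolding pq carr by auto
    then show ?thesis unfolding pq mult carr by (intro SigmaI mF Qc)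
  qed
  have assoc: "(p \<star>\<^bsub>sem ?W\<^esub> q) \<star>\<^bsub>sem ?W\<^esub> r = p \<star>\<^bsub>sem ?W\<^esub> (q \<star>\<^bsub>sem ?W\<^esub> r)"
    if p: "p \<in> carrier (sem ?W)" and q: "q \<in> carrier (sem ?W)" and r: "r \<in> carrier (sem ?W)"
    for p q r
  proof -
    obtain f t g u h v where pqr: "p = (f, t)" "q = (g, u)" "r = (h, v)"
      by (cases p, cases q, cases r)
    from p q r have *: "f \<in> ?F" "g \<in> ?F" "h \<in> ?F"
      "t \<in> carrier (sem Q)" "u \<in> carrier (sem Q)" "v \<in> carrier (sem Q)"
      unfolding pqr carr by auto
    have "?m (?m f t g) (t \<star>\<^bsub>sem Q\<^esub> u) h = ?m f t (?m g u h)"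
      by (rule restrict_ext) (simp add: * F Qp Qc Pa Qact)
    then show ?thesis unfolding pqr mult by (simp add: * Qa)
  qed
  have sg: "is_semigroup (sem ?W)"
    unfolding is_semigroup_def using ne' closed assoc by blast
  have 1: "act ?W z p \<in> points ?W" if z: "z \<in> points ?W" and p: "p \<in> carrier (sem ?W)" for z p
  proof -
    obtain x y f t where zp: "z = (x, y)" "p = (f, t)" by (cases z, cases p)
    from z p have *: "x \<in> points P" "y \<in> points Q" "f \<in> ?F" "t \<in> carrier (sem Q)"
      unfolding zp carr pts by auto
    show ?thesis unfolding zp act pts by (intro SigmaI Pp Qp F *)
  qed
  have 2: "act ?W z (p \<star>\<^bsub>sem ?W\<^esub> q) = act ?W (act ?W z p) q"
    if z: "z \<in> points ?W" and p: "p \<in> carrier (sem ?W)" and q: "q \<in> carrier (sem ?W)" for z p q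
  proof -
    obtain x y f t g u where zpq: "z = (x, y)" "p = (f, t)" "q = (g, u)"
      by (cases z, cases p, cases q)
    from z p q have *: "x \<in> points P" "y \<in> points Q" "f \<in> ?F" "g \<in> ?F"
      "t \<in> carrier (sem Q)" "u \<in> carrier (sem Q)"
      unfolding zpq carr pts by auto
    show ?thesis unfolding zpq mult act by (simp add: * F Qp Pact Qact)
  qed
  have 3: "p = q"
    if p: "p \<in> carrier (sem ?W)" and q: "q \<in> carrier (sem ?W)"
      and eq: "\<forall>z\<in>points ?W. act ?W z p = act ?W z q" for p q
  proof -
    obtain f t g u where pq: "p = (f, t)" "q = (g, u)" by (cases p, cases q)
    from p q have *: "f \<in> ?F" "g \<in> ?F" "t \<in> carrier (sem Q)" "u \<in> carrier (sem Q)"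
      unfolding pq carr by auto
    have eq': "act P x (f y) = act P x (g y)" "act Q y t = act Q y u"
      if "x \<in> points P" "y \<in> points Q" for x y
      using bspec[OF eq, of "(x, y)"] that by (simp_all add: pq pts act)
    obtain x where "x \<in> points P" using ne by blast
    then have "\<forall>y\<in>points Q. act Q y t = act Q y u" using eq' by blast
    then have "t = u" using Q * unfolding is_tsg_def by blast
    moreover have "f = g"
    proof (rule PiE_ext[OF *(1,2)])
      fix y assume y: "y \<in> points Q"
      then have "\<forall>x\<in>points P. act P x (f y) = act P x (g y)" using eq' by blast
      then show "f y = g y"
        using P F[OF *(1) y] F[OF *(2) y] unfolding is_tsg_def by blast
    qed
    ultimately show ?thesis by (simp add: pq)
  qed
  show ?thesis
    unfolding is_tsg_def using sg 1 2 3 by blast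
qed

text \<open>The step in \<^const>\<open>kr_product\<close> never fails for lack of an isomorphic copy.\<close>

lemma ex_nat_copy:
  assumes "finite (points P)" and "finite (carrier (sem P))"
  shows "\<exists>T :: (nat, nat) tsg. tsg_iso P T"
proof -
  obtain \<phi> :: "_ \<Rightarrow> nat" where \<phi>: "inj_on \<phi> (points P)"
    using finite_imp_inj_to_nat_seg[OF assms(1)] by blast
  obtain \<psi> :: "_ \<Rightarrow> nat" where \<psi>: "inj_on \<psi> (carrier (sem P))"
    using finite_imp_inj_to_nat_seg[OF assms(2)] by blast
  let ?\<phi>' = "inv_into (points P) \<phi>" and ?\<psi>' = "inv_into (carrier (sem P)) \<psi>"
  let ?T = "\<lparr>points = \<phi> ` points P,
      sem = \<lparr>carrier = \<psi> ` carrier (sem P),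
             sg_mult = (\<lambda>a b. \<psi> (?\<psi>' a \<star>\<^bsub>sem P\<^esub> ?\<psi>' b))\<rparr>,
      act = (\<lambda>n a. \<phi> (act P (?\<phi>' n) (?\<psi>' a)))\<rparr>"
  have "tsg_iso P ?T"
    unfolding tsg_iso_def
    by (rule exI[of _ \<phi>], rule exI[of _ \<psi>]) (simp add: bij_betw_def \<phi> \<psi>)
  then show ?thesis by blast
qed

end

theory Submission
  imports Defs "HOL-Algebra.Multiplicative_Group" "HOL-Combinatorics.Permutations"
begin

text \<open>Maps in \<open>MR \<Gamma>\<close> have fibres of at most two points, and a fibre of two points is an
  edge. Moreover the preimage of an edge is at most an edge, so every map moves the edges that it
  does not destroy injectively. These two facts give complexity at most 2 for every finite simple
  graph (\<open>MR_divides_kr_product_2\<close>).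

  Reading a product \<open>r = f\<^sub>1 f\<^sub>2 \<dots>\<close> from left to right, a lower level \<open>A\<^sub>1 \<wr> G\<^sub>1\<close> follows the
  directed edges. Its group component permutes them by some extension of the partial injection
  induced by \<open>f\<^sub>i\<close>, and its aperiodic component stores one flag per edge: a flag on \<open>(a, b)\<close> says that
  \<open>a\<close> is not in the image of \<open>r\<close>, and an edge without flags has both ends in the image. Flags
  are only ever overwritten by constants, so this component is a band. When the next map \<open>f\<close> identifies
  two points \<open>a, b\<close>, the flags tell which of them is absent, or else that both are present. Hence
  they tell how to choose representatives on which \<open>f\<close> is injective and such that every
  point of the image of \<open>r\<close> in the domain of \<open>f\<close> has the same value as a chosen point of that image. The
  upper level \<open>A\<^sub>2 \<wr> G\<^sub>2\<close> writes \<open>r = \<delta> \<circ> F\<close> with a permutation \<open>\<delta>\<close> of the vertices, updated by an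
  extension of \<open>f\<close> on the representatives, and a partial map \<open>F\<close> whose image never leaves its
  previous image and shrinks whenever \<open>F\<close> changes. A semigroup of such descending maps is aperiodic.

  For the lower bound, suppose that \<open>S \<prec> A\<^sub>1 \<wr> G \<wr> A\<^sub>0\<close> and that \<open>x, t \<in> S\<close>, where \<open>x\<close> lies in a
  subgroup whose identity is a right identity of \<open>t\<close>. Suitable lifts of \<open>x\<close> and \<open>t\<close> fix a common set of
  states of \<open>A\<^sub>0\<close>, namely the states reached through a high power of the lift of \<open>t\<close>. On these states
  words in \<open>x\<close> and \<open>t\<close> act on the \<open>G\<close>-component by translations, so a word that is trivial in every
  group of a large exponent \<open>m\<close> moves only the \<open>A\<^sub>1\<close>-component. If such a word has value \<open>k\<close>, then
  \<open>t\<^sup>m k\<^sup>m = t\<^sup>m k\<^sup>m\<^sup>+\<^sup>1\<close> by aperiodicity of \<open>A\<^sub>1\<close>; this is \<open>complexity_one_obstruction\<close>. On the first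
  six vertices of a path, the reflection and one further map admit such a word that interchanges the
  vertices 1 and 3, which contradicts this equation (\<open>not_divides_kr_product_1\<close>).\<close>

section \<open>Powers and aperiodicity in finite semigroups\<close>

lemma semigroup_closed:
  assumes "is_semigroup S" "x \<in> carrier S" "y \<in> carrier S"
  shows "x \<star>\<^bsub>S\<^esub> y \<in> carrier S"
  using assms unfolding is_semigroup_def by blast

lemma semigroup_assoc:
  assumes "is_semigroup S" "x \<in> carrier S" "y \<in> carrier S" "z \<in> carrier S"
  shows "(x \<star>\<^bsub>S\<^esub> y) \<star>\<^bsub>S\<^esub> z = x \<star>\<^bsub>S\<^esub> (y \<star>\<^bsub>S\<^esub> z)"
  using assms unfolding is_semigroup_def by blast

text \<open>A semigroup has no zeroth powers; the value at exponent \<open>0\<close> is a dummy.\<close>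

primrec sg_pow :: "'a sgrp \<Rightarrow> 'a \<Rightarrow> nat \<Rightarrow> 'a" where
  "sg_pow S x 0 = x"
| "sg_pow S x (Suc n) = (if n = 0 then x else sg_pow S x n \<star>\<^bsub>S\<^esub> x)"

lemma sg_pow_closed:
  assumes "is_semigroup S" "x \<in> carrier S"
  shows "sg_pow S x n \<in> carrier S"
  by (induction n) (auto intro: semigroup_closed[OF assms(1)] assms(2))

lemma sg_pow_add:
  assumes S: "is_semigroup S" and x: "x \<in> carrier S" and m: "m > 0" and n: "n > 0"
  shows "sg_pow S x (m + n) = sg_pow S x m \<star>\<^bsub>S\<^esub> sg_pow S x n"
  using n
proof (induction n rule: nat_induct_non_zero)
  case 1
  then show ?case using m by simp
next
  case (Suc n)
  then show ?case
    using m by (simp add: semigroup_assoc[OF S] sg_pow_closed[OF S] x)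
qed

lemma sg_pow_mult:
  assumes S: "is_semigroup S" and x: "x \<in> carrier S" and m: "m > 0" and n: "n > 0"
  shows "sg_pow S x (m * n) = sg_pow S (sg_pow S x m) n"
  using n
proof (induction n rule: nat_induct_non_zero)
  case 1
  then show ?case by simp
next
  case (Suc n)
  have "sg_pow S x (m * Suc n) = sg_pow S x (m * n + m)" by (simp add: add.commute)
  also have "\<dots> = sg_pow S x (m * n) \<star>\<^bsub>S\<^esub> sg_pow S x m"
    using m Suc by (intro sg_pow_add S x) auto
  finally show ?case using Suc by simp
qed

lemma sg_pow_hom:
  assumes S: "is_semigroup S" and x: "x \<in> carrier S"
    and hom: "\<And>x y. x \<in> carrier S \<Longrightarrow> y \<in> carrier S \<Longrightarrow> h (x \<star>\<^bsub>S\<^esub> y) = h x \<star>\<^bsub>R\<^esub> h y"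
  shows "h (sg_pow S x n) = sg_pow R (h x) n"
  by (induction n) (simp_all add: hom x sg_pow_closed[OF S x])

lemma sg_pow_period:
  assumes S: "is_semigroup S" and x: "x \<in> carrier S"
    and i: "i > 0" and eq: "sg_pow S x (i + d) = sg_pow S x i" and k: "i \<le> k"
  shows "sg_pow S x (k + d * n) = sg_pow S x k"
proof (cases "d = 0")
  case False
  have one: "sg_pow S x (k + d) = sg_pow S x k" if "i \<le> k" for k
  proof (cases "k = i")
    case False
    then have *: "k + d = (i + d) + (k - i)" "k = i + (k - i)" "k - i > 0" using that by auto
    have "sg_pow S x (k + d) = sg_pow S x (i + d) \<star>\<^bsub>S\<^esub> sg_pow S x (k - i)"
      by (subst *(1), rule sg_pow_add) (use S x i * in auto)
    also have "\<dots> = sg_pow S x (i + (k - i))"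
      unfolding eq by (rule sg_pow_add[symmetric]) (use S x i * in auto)
    finally show ?thesis using *(2) by simp
  qed (use eq in simp)
  show ?thesis
  proof (induction n)
    case (Suc n)
    have "sg_pow S x (k + d * Suc n) = sg_pow S x ((k + d * n) + d)" by (simp add: algebra_simps)
    also have "\<dots> = sg_pow S x (k + d * n)" using k by (intro one) simp
    finally show ?case using Suc by simp
  qed simp
qed simp

lemma is_groupI:
  assumes "is_semigroup S" "is_identity S e"
    and "\<And>x. x \<in> carrier S \<Longrightarrow> \<exists>y\<in>carrier S. y \<star>\<^bsub>S\<^esub> x = e"
  shows "is_group S"
  unfolding is_group_def
proof (rule exI[of _ e], rule groupI)
qed (use assms in \<open>auto simp: is_identity_def semigroup_closed semigroup_assoc\<close>)

lemma is_group_semigroup: "is_group G \<Longrightarrow> is_semigroup G"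
  unfolding is_group_def is_semigroup_def
  by (metis (no_types, lifting) empty_iff group.is_monoid monoid.m_assoc monoid.m_closed
      monoid.one_closed monoid.select_convs(1) partial_object.select_convs(1))

text \<open>The powers \<open>x\<^sup>i, x\<^sup>i\<^sup>+\<^sup>1, \<dots>\<close> from the point where they become periodic form a cyclic
  group. Aperiodicity makes it trivial; the index \<open>i\<close> is at most the number of elements.\<close>

lemma aperiodic_sg_pow_stable:
  assumes S: "is_semigroup S" and fin: "finite (carrier S)" and ap: "is_aperiodic S"
    and x: "x \<in> carrier S" and n: "card (carrier S) \<le> n"
  shows "sg_pow S x (Suc n) = sg_pow S x n"
proof -
  let ?p = "sg_pow S x"
  have "\<not> inj_on ?p {1..Suc (card (carrier S))}"
  proof
    assume "inj_on ?p {1..Suc (card (carrier S))}"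
    then have "card {1..Suc (card (carrier S))} \<le> card (carrier S)"
      by (rule card_inj_on_le) (use fin sg_pow_closed[OF S x] in auto)
    then show False by simp
  qed
  then have "\<exists>i j. 1 \<le> i \<and> i < j \<and> j \<le> Suc (card (carrier S)) \<and> ?p i = ?p j"
    by (auto simp: inj_on_def) (metis nat_neq_iff)
  then obtain i j where ij: "1 \<le> i" "i < j" "j \<le> Suc (card (carrier S))" and pij: "?p i = ?p j"
    by blast
  define d where "d = j - i"
  have d: "j = i + d" "d > 0" and i: "i > 0" "i \<le> card (carrier S)"
    using ij by (auto simp: d_def)
  have per: "?p (k + d * n) = ?p k" if "i \<le> k" for k n
    using sg_pow_period[OF S x i(1) _ that, of d n] pij d(1) by simp
  have add: "?p (k + l) = ?p k \<star>\<^bsub>S\<^esub> ?p l" if "k > 0" "l > 0" for k l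
    using that by (rule sg_pow_add[OF S x])
  let ?H = "?p ` {i..}"
  have id: "i \<le> d * i" using d by (cases d) auto
  have "is_group (S\<lparr>carrier := ?H\<rparr>)"
  proof (rule is_groupI[where e = "?p (d * i)"])
    have "?p k \<star>\<^bsub>S\<^esub> ?p l \<in> ?H" if "i \<le> k" "i \<le> l" for k l
      using add[of k l] that i(1) by (auto intro!: image_eqI[of _ _ "k + l"])
    then show "is_semigroup (S\<lparr>carrier := ?H\<rparr>)"
      unfolding is_semigroup_def
      by (auto simp: semigroup_assoc[OF S] sg_pow_closed[OF S x])
    have "?p (d * i) \<star>\<^bsub>S\<^esub> ?p k = ?p k" "?p k \<star>\<^bsub>S\<^esub> ?p (d * i) = ?p k" if "i \<le> k" for k
    proof -
      have "?p (d * i) \<star>\<^bsub>S\<^esub> ?p k = ?p (d * i + k)" "?p k \<star>\<^bsub>S\<^esub> ?p (d * i) = ?p (k + d * i)"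
        using add that i(1) d(2) by simp_all
      then show "?p (d * i) \<star>\<^bsub>S\<^esub> ?p k = ?p k" "?p k \<star>\<^bsub>S\<^esub> ?p (d * i) = ?p k"
        using per[OF that, of i] by (simp_all add: add.commute)
    qed
    then show "is_identity (S\<lparr>carrier := ?H\<rparr>) (?p (d * i))"
      unfolding is_identity_def using id by auto
    show "\<exists>y\<in>carrier (S\<lparr>carrier := ?H\<rparr>). y \<star>\<^bsub>S\<lparr>carrier := ?H\<rparr>\<^esub> z = ?p (d * i)"
      if z: "z \<in> carrier (S\<lparr>carrier := ?H\<rparr>)" for z
    proof -
      obtain k where k: "i \<le> k" "z = ?p k" using z by auto
      \<comment> \<open>The inverse of \<open>x\<^sup>k\<close>: the exponents \<open>l\<close> and \<open>k\<close> add up to a multiple of the period \<open>d\<close>, and the summand \<open>d * i\<close> keeps \<open>l\<close> in the periodic range.\<close>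
      define l where "l = (d - 1) * k + d * i"
      have l: "i \<le> l" unfolding l_def using id by (rule trans_le_add2)
      obtain d' where d': "d = Suc d'" using d(2) by (cases d) auto
      have "l + k = d * i + d * k" by (simp add: l_def d' algebra_simps)
      then have "?p l \<star>\<^bsub>S\<^esub> ?p k = ?p (d * i + d * k)"
        using add[of l k] i(1) k l by simp
      then show ?thesis using k l per[OF id, of k] by auto
    qed
  qed
  moreover have "?H \<subseteq> carrier S" using sg_pow_closed[OF S x] by auto
  ultimately obtain e where e: "?H = {e}" using ap unfolding is_aperiodic_def by blast
  have "?p (Suc n) \<in> ?H" "?p n \<in> ?H" using i n by (auto simp del: sg_pow.simps)
  then have "?p (Suc n) = e" "?p n = e" unfolding e by blast+
  then show ?thesis by simp
qed

lemma aperiodicI: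
  assumes S: "is_semigroup S"
    and stable: "\<And>x. x \<in> carrier S \<Longrightarrow> \<exists>n>0. sg_pow S x (Suc n) = sg_pow S x n"
  shows "is_aperiodic S"
  unfolding is_aperiodic_def
proof (intro allI impI)
  fix H assume H: "H \<subseteq> carrier S \<and> is_group (S\<lparr>carrier := H\<rparr>)"
  then obtain e where G: "group \<lparr>carrier = H, monoid.mult = sg_mult S, one = e\<rparr>" (is "group ?G")
    by (auto simp: is_group_def)
  interpret group ?G by (rule G)
  have "x = e" if x: "x \<in> H" for x
  proof -
    obtain n where n: "n > 0" "sg_pow S x (Suc n) = sg_pow S x n" using stable H x by blast
    have p: "sg_pow S x n \<in> H" for n
      by (induction n) (use x m_closed in auto)
    have "sg_pow S x n \<star>\<^bsub>S\<^esub> x = sg_pow S x n" using n by simp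
    then show ?thesis using l_cancel_one[of "sg_pow S x n" x] p[of n] x by simp
  qed
  moreover have "e \<in> H" using one_closed by simp
  ultimately show "\<exists>e. H = {e}" by blast
qed

lemma semigroup_hom_image:
  assumes S: "is_semigroup S" and onto: "h ` carrier S = carrier R"
    and hom: "\<And>x y. x \<in> carrier S \<Longrightarrow> y \<in> carrier S \<Longrightarrow> h (x \<star>\<^bsub>S\<^esub> y) = h x \<star>\<^bsub>R\<^esub> h y"
  shows "is_semigroup R"
  unfolding is_semigroup_def onto[symmetric]
  using S by (auto simp: hom[symmetric] is_semigroup_def)

lemma identity_hom_image:
  assumes e: "is_identity S e" and onto: "h ` carrier S = carrier R"
    and hom: "\<And>x y. x \<in> carrier S \<Longrightarrow> y \<in> carrier S \<Longrightarrow> h (x \<star>\<^bsub>S\<^esub> y) = h x \<star>\<^bsub>R\<^esub> h y"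
  shows "is_identity R (h e)"
  unfolding is_identity_def onto[symmetric]
  using e by (auto simp: hom[symmetric] is_identity_def)

lemma nat_copy:
  fixes S :: "'a sgrp"
  assumes S: "is_semigroup S" and fin: "finite (carrier S)"
  obtains R :: "nat sgrp" and h
  where "bij_betw h (carrier S) (carrier R)"
    "\<And>x y. x \<in> carrier S \<Longrightarrow> y \<in> carrier S \<Longrightarrow> h (x \<star>\<^bsub>S\<^esub> y) = h x \<star>\<^bsub>R\<^esub> h y"
proof -
  obtain h :: "'a \<Rightarrow> nat" where h: "inj_on h (carrier S)"
    using finite_imp_inj_to_nat_seg[OF fin] by blast
  let ?k = "inv_into (carrier S) h"
  let ?R = "\<lparr>carrier = h ` carrier S, sg_mult = \<lambda>a b. h (?k a \<star>\<^bsub>S\<^esub> ?k b)\<rparr>"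
  show thesis
    by (rule that[of h ?R]) (simp_all add: bij_betw_def h)
qed

section \<open>Isomorphic transformation semigroups\<close>

lemma tsg_iso_is_tsg:
  assumes P: "is_tsg P" and iso: "tsg_iso P Q"
  shows "is_tsg Q"
proof -
  obtain \<phi> \<psi> where \<phi>: "bij_betw \<phi> (points P) (points Q)"
    and \<psi>: "bij_betw \<psi> (carrier (sem P)) (carrier (sem Q))"
    and hom: "\<And>s t. s \<in> carrier (sem P) \<Longrightarrow> t \<in> carrier (sem P) \<Longrightarrow>
           \<psi> (s \<star>\<^bsub>sem P\<^esub> t) = \<psi> s \<star>\<^bsub>sem Q\<^esub> \<psi> t"
    and act: "\<And>x s. x \<in> points P \<Longrightarrow> s \<in> carrier (sem P) \<Longrightarrow> \<phi> (act P x s) = act Q (\<phi> x) (\<psi> s)"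
    using iso unfolding tsg_iso_def by blast
  have im: "points Q = \<phi> ` points P" "carrier (sem Q) = \<psi> ` carrier (sem P)"
    using \<phi> \<psi> by (simp_all add: bij_betw_def)
  have SP: "is_semigroup (sem P)"
    and aP: "\<And>x s. x \<in> points P \<Longrightarrow> s \<in> carrier (sem P) \<Longrightarrow> act P x s \<in> points P"
    and mP: "\<And>x s t. x \<in> points P \<Longrightarrow> s \<in> carrier (sem P) \<Longrightarrow> t \<in> carrier (sem P) \<Longrightarrow>
        act P x (s \<star>\<^bsub>sem P\<^esub> t) = act P (act P x s) t"
    and fP: "\<And>s t. s \<in> carrier (sem P) \<Longrightarrow> t \<in> carrier (sem P) \<Longrightarrow>
        (\<forall>x\<in>points P. act P x s = act P x t) \<Longrightarrow> s = t"
    using P unfolding is_tsg_def by blast+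
  have 0: "is_semigroup (sem Q)"
    by (rule semigroup_hom_image[OF SP _ hom]) (simp_all add: im)
  have 1: "act Q x s \<in> points Q" if "x \<in> points Q" "s \<in> carrier (sem Q)" for x s
    using that unfolding im by (auto simp: act[symmetric] aP)
  have 2: "act Q x (s \<star>\<^bsub>sem Q\<^esub> t) = act Q (act Q x s) t"
    if "x \<in> points Q" "s \<in> carrier (sem Q)" "t \<in> carrier (sem Q)" for x s t
    using that semigroup_closed[OF SP] unfolding im
    by (auto simp: act[symmetric] hom[symmetric] aP mP)
  have 3: "s = t" if st: "s \<in> carrier (sem Q)" "t \<in> carrier (sem Q)"
    and eq: "\<forall>x\<in>points Q. act Q x s = act Q x t" for s t
  proof -
    obtain s' t' where s': "s' \<in> carrier (sem P)" "s = \<psi> s'" and t': "t' \<in> carrier (sem P)" "t = \<psi> t'"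
      using st unfolding im by blast
    have "act P x s' = act P x t'" if x: "x \<in> points P" for x
    proof (rule inj_onD[OF bij_betw_imp_inj_on[OF \<phi>]])
      show "\<phi> (act P x s') = \<phi> (act P x t')"
        using eq x s' t' by (simp add: act im)
    qed (use aP x s' t' in auto)
    then show ?thesis using fP s' t' by blast
  qed
  show ?thesis unfolding is_tsg_def using 0 1 2 3 by blast
qed

lemma regular_tsg_points:
  assumes "is_identity S e"
  shows "points (regular_tsg S) = Some ` carrier S"
  using assms by (auto simp: regular_tsg_def)

lemma regular_tsg_simps [simp]:
  "sem (regular_tsg S) = S"
  "act (regular_tsg S) (Some r) s = Some (r \<star>\<^bsub>S\<^esub> s)"
  by (simp_all add: regular_tsg_def)

lemma wreath_simps [simp]:
  "points (P \<wr> Q) = points P \<times> points Q"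
  "carrier (sem (P \<wr> Q)) = (points Q \<rightarrow>\<^sub>E carrier (sem P)) \<times> carrier (sem Q)"
  "(f, t) \<star>\<^bsub>sem (P \<wr> Q)\<^esub> (g, u) =
     (\<lambda>y\<in>points Q. f y \<star>\<^bsub>sem P\<^esub> g (act Q y t), t \<star>\<^bsub>sem Q\<^esub> u)"
  "act (P \<wr> Q) (x, y) (f, t) = (act P x (f y), act Q y t)"
  by (simp_all add: wreath_def)

section \<open>Simulating a monoid by a Krohn-Rhodes product\<close>

text \<open>\<open>R z r\<close> reads: the state \<open>z\<close> may represent the element \<open>r\<close>. A state may represent several elements,
  so a level of a cascade can record partial information about a product of elements of \<open>S\<close>; a
  relation that determines \<open>r\<close> from \<open>z\<close> yields a division. Only the existence of one lift of each
  \<open>s\<close> has to be checked, without computing in the semigroup of the cascade.\<close>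

definition covers :: "('x, 't) tsg \<Rightarrow> 's sgrp \<Rightarrow> 's \<Rightarrow> ('x \<Rightarrow> 's \<Rightarrow> bool) \<Rightarrow> bool" where
  "covers T S e R \<longleftrightarrow>
     (\<exists>z\<in>points T. R z e) \<and>
     (\<forall>s\<in>carrier S. \<exists>t\<in>carrier (sem T). \<forall>z\<in>points T. \<forall>r\<in>carrier S.
        R z r \<longrightarrow> R (act T z t) (r \<star>\<^bsub>S\<^esub> s))"

lemma covers_iso:
  assumes P: "is_tsg P" and cov: "covers P S e R" and iso: "tsg_iso P T"
  shows "\<exists>d. covers T S e (\<lambda>z. R (d z))"
proof -
  obtain \<phi> \<psi> where \<phi>: "bij_betw \<phi> (points P) (points T)"
    and \<psi>: "bij_betw \<psi> (carrier (sem P)) (carrier (sem T))"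
    and act: "\<And>x s. x \<in> points P \<Longrightarrow> s \<in> carrier (sem P) \<Longrightarrow> \<phi> (act P x s) = act T (\<phi> x) (\<psi> s)"
    using iso unfolding tsg_iso_def by blast
  have im: "points T = \<phi> ` points P" "carrier (sem T) = \<psi> ` carrier (sem P)"
    using \<phi> \<psi> by (simp_all add: bij_betw_def)
  define d where "d = inv_into (points P) \<phi>"
  have d: "d (\<phi> x) = x" if "x \<in> points P" for x
    unfolding d_def using \<phi> that by (simp add: bij_betw_def)
  have "\<exists>z\<in>points T. R (d z) e"
    using cov unfolding covers_def im by (auto simp: d)
  moreover have "\<exists>t\<in>carrier (sem T). \<forall>z\<in>points T. \<forall>r\<in>carrier S.
      R (d z) r \<longrightarrow> R (d (act T z t)) (r \<star>\<^bsub>S\<^esub> s)" if s: "s \<in> carrier S" for s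
  proof -
    obtain t where t: "t \<in> carrier (sem P)"
      and lift: "\<And>z r. z \<in> points P \<Longrightarrow> r \<in> carrier S \<Longrightarrow> R z r \<Longrightarrow> R (act P z t) (r \<star>\<^bsub>S\<^esub> s)"
      using cov s unfolding covers_def by blast
    have "act P x t \<in> points P" if "x \<in> points P" for x
      using P t that unfolding is_tsg_def by blast
    then have "\<forall>z\<in>points T. \<forall>r\<in>carrier S.
        R (d z) r \<longrightarrow> R (d (act T z (\<psi> t))) (r \<star>\<^bsub>S\<^esub> s)"
      unfolding im by (auto simp: d t act[symmetric] lift)
    then show ?thesis using t im by blast
  qed
  ultimately show ?thesis unfolding covers_def by blast
qed

text \<open>The elements of \<open>sem T\<close> that lift some \<open>s\<close> form a subsemigroup. Each lifts only one \<open>s\<close>,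
  because it sends an initial state to a state that represents \<open>s\<close>.\<close>

lemma covers_imp_divides:
  assumes T: "is_tsg T" and S: "is_semigroup S" and e: "is_identity S e"
    and cov: "covers T S e R"
    and unique: "\<And>z r r'. r \<in> carrier S \<Longrightarrow> r' \<in> carrier S \<Longrightarrow> R z r \<Longrightarrow> R z r' \<Longrightarrow> r = r'"
  shows "S \<prec> sem T"
proof -
  define lifts where "lifts t s \<longleftrightarrow> t \<in> carrier (sem T) \<and> s \<in> carrier S \<and>
      (\<forall>z\<in>points T. \<forall>r\<in>carrier S. R z r \<longrightarrow> R (act T z t) (r \<star>\<^bsub>S\<^esub> s))" for t s
  have ex: "\<exists>t. lifts t s" if "s \<in> carrier S" for s
    using cov that unfolding covers_def lifts_def by blast
  have ST: "is_semigroup (sem T)"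
    and aT: "\<And>x s. x \<in> points T \<Longrightarrow> s \<in> carrier (sem T) \<Longrightarrow> act T x s \<in> points T"
    and mT: "\<And>x s t. x \<in> points T \<Longrightarrow> s \<in> carrier (sem T) \<Longrightarrow> t \<in> carrier (sem T) \<Longrightarrow>
        act T x (s \<star>\<^bsub>sem T\<^esub> t) = act T (act T x s) t"
    using T unfolding is_tsg_def by blast+
  have eS: "e \<in> carrier S" "e \<star>\<^bsub>S\<^esub> s = s" if "s \<in> carrier S" for s
    using e that unfolding is_identity_def by blast+
  have prod: "lifts (t \<star>\<^bsub>sem T\<^esub> t') (s \<star>\<^bsub>S\<^esub> s')" if "lifts t s" "lifts t' s'" for t t' s s'
    using that unfolding lifts_def
    by (auto simp: semigroup_closed[OF S] semigroup_closed[OF ST] mT aT semigroup_assoc[OF S, symmetric])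
  have uniq: "s = s'" if l: "lifts t s" "lifts t s'" for t s s'
  proof -
    obtain z where z: "z \<in> points T" "R z e" using cov unfolding covers_def by blast
    have "R (act T z t) s" "R (act T z t) s'"
      using l z eS unfolding lifts_def by metis+
    then show ?thesis using unique l unfolding lifts_def by blast
  qed
  define h where "h t = (THE s. lifts t s)" for t
  have h: "h t = s" if "lifts t s" for t s
    unfolding h_def using that uniq by blast
  define U where "U = {t. \<exists>s. lifts t s}"
  have U: "U \<subseteq> carrier (sem T)" unfolding U_def lifts_def by blast
  have closed: "t \<star>\<^bsub>sem T\<^esub> t' \<in> U" if "t \<in> U" "t' \<in> U" for t t'
    using that prod unfolding U_def by blast
  have "U \<noteq> {}" using ex eS(1) S unfolding U_def is_semigroup_def by blast
  then have "is_subsemigroup U (sem T)"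
    unfolding is_subsemigroup_def is_semigroup_def
    using U closed semigroup_assoc[OF ST] by (auto simp: subset_iff)
  moreover have "h ` U = carrier S"
  proof
    show "h ` U \<subseteq> carrier S" using h by (auto simp: U_def lifts_def)
    show "carrier S \<subseteq> h ` U" using ex h unfolding U_def by blast
  qed
  moreover have "\<forall>x\<in>U. \<forall>y\<in>U. h (x \<star>\<^bsub>sem T\<^esub> y) = h x \<star>\<^bsub>S\<^esub> h y"
    using h prod unfolding U_def by auto
  ultimately show ?thesis unfolding sg_divides_def by blast
qed

text \<open>The map \<open>d\<close> decodes the natural numbers that \<^const>\<open>kr_product\<close> uses as states into states of the
  type in which the levels are described.\<close>

definition kr_covers :: "nat \<Rightarrow> 's sgrp \<Rightarrow> 's \<Rightarrow> ('q \<Rightarrow> 's \<Rightarrow> bool) \<Rightarrow> bool" where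
  "kr_covers n S e Q \<longleftrightarrow>
     (\<exists>T d. kr_product n T \<and> is_tsg T \<and> finite (points T) \<and> finite (carrier (sem T)) \<and>
        covers T S e (\<lambda>z. Q (d z)))"

lemma tsg_iso_finite:
  assumes "tsg_iso P Q" "finite (points P)" "finite (carrier (sem P))"
  shows "finite (points Q)" "finite (carrier (sem Q))"
  using assms unfolding tsg_iso_def by (auto dest: bij_betw_finite)

lemma kr_covers_0: "kr_covers 0 S e (\<lambda>_ _. True)"
proof -
  let ?A = "\<lparr>carrier = {0}, sg_mult = \<lambda>_ _. 0\<rparr> :: nat sgrp"
  have A: "is_semigroup ?A" by (simp add: is_semigroup_def)
  have ap: "is_aperiodic ?A" by (rule aperiodicI[OF A]) (auto intro!: exI[of _ "Suc 0"])
  have "is_identity ?A 0" by (simp add: is_identity_def)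
  then have pts: "points (regular_tsg ?A) = {Some 0}" by (simp add: regular_tsg_points)
  obtain T :: "(nat, nat) tsg" where T: "tsg_iso (regular_tsg ?A) T"
    using ex_nat_copy[of "regular_tsg ?A"] pts by auto
  have "kr_product 0 T" using A ap T by (intro kr_product.base) auto
  moreover have tsg: "is_tsg T" using T tsg_iso_is_tsg is_tsg_regular[OF A] by blast
  moreover have "finite (points T)" "finite (carrier (sem T))"
    using tsg_iso_finite[OF T] pts by auto
  moreover have "covers T S e (\<lambda>_ _. True)"
  proof -
    have "\<exists>d :: nat \<Rightarrow> nat option. covers T S e (\<lambda>z. (\<lambda>_ _. True) (d z))"
      by (rule covers_iso[OF is_tsg_regular[OF A] _ T]) (simp add: covers_def pts)
    then show ?thesis by simp
  qed
  ultimately show ?thesis unfolding kr_covers_def by blast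
qed

text \<open>One more level \<open>A \<wr> G\<close> on top of a cascade. The group element \<open>\<gamma>\<close> of a lift may depend on the lower
  state \<open>q\<close>, and the element \<open>\<alpha>\<close> of \<open>A\<close> also on the state of \<open>G\<close>. The new lower state \<open>q'\<close> is an arbitrary
  one that is consistent with the new product, so the lower level can be used as a black box.\<close>

lemma kr_covers_Suc:
  fixes A :: "'a sgrp" and G :: "'g sgrp" and Q' :: "'a \<times> 'g \<times> 'q \<Rightarrow> 's \<Rightarrow> bool"
  assumes cov: "kr_covers n S e Q"
    and A: "is_semigroup A" "finite (carrier A)" "is_aperiodic A" "is_identity A a1"
    and G: "is_group G" "finite (carrier G)" "is_identity G g1"
    and lower: "\<And>a g q r. Q' (a, g, q) r \<Longrightarrow> Q q r"
    and init: "\<And>q. Q q e \<Longrightarrow> Q' (a1, g1, q) e"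
    and lift: "\<And>s. s \<in> carrier S \<Longrightarrow> \<exists>\<gamma> \<alpha>. (\<forall>q. \<gamma> q \<in> carrier G) \<and> (\<forall>g q. \<alpha> g q \<in> carrier A) \<and>
        (\<forall>a g q q' r. a \<in> carrier A \<longrightarrow> g \<in> carrier G \<longrightarrow> r \<in> carrier S \<longrightarrow> Q' (a, g, q) r \<longrightarrow>
           Q q' (r \<star>\<^bsub>S\<^esub> s) \<longrightarrow> Q' (a \<star>\<^bsub>A\<^esub> \<alpha> g q, g \<star>\<^bsub>G\<^esub> \<gamma> q, q') (r \<star>\<^bsub>S\<^esub> s))"
  shows "kr_covers (Suc n) S e Q'"
proof -
  obtain T d where T: "kr_product n T" "is_tsg T" "finite (points T)" "finite (carrier (sem T))"
    and covT: "covers T S e (\<lambda>z. Q (d z))"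
    using cov unfolding kr_covers_def by blast
  obtain B :: "nat sgrp" and h where h: "bij_betw h (carrier A) (carrier B)"
    and hom: "\<And>x y. x \<in> carrier A \<Longrightarrow> y \<in> carrier A \<Longrightarrow> h (x \<star>\<^bsub>A\<^esub> y) = h x \<star>\<^bsub>B\<^esub> h y"
    by (rule nat_copy[OF A(1,2)]) blast
  obtain H :: "nat sgrp" and k where k: "bij_betw k (carrier G) (carrier H)"
    and kom: "\<And>x y. x \<in> carrier G \<Longrightarrow> y \<in> carrier G \<Longrightarrow> k (x \<star>\<^bsub>G\<^esub> y) = k x \<star>\<^bsub>H\<^esub> k y"
    by (rule nat_copy[OF is_group_semigroup[OF G(1)] G(2)]) blast
  have im: "carrier B = h ` carrier A" "carrier H = k ` carrier G"
    using h k by (simp_all add: bij_betw_def)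
  note SG = is_group_semigroup[OF G(1)]
  have SB: "is_semigroup B" by (rule semigroup_hom_image[OF A(1) _ hom]) (simp_all add: im)
  have SH: "is_semigroup H" by (rule semigroup_hom_image[OF SG _ kom]) (simp_all add: im)
  have eB: "is_identity B (h a1)" by (rule identity_hom_image[OF A(4) _ hom]) (simp_all add: im)
  have eH: "is_identity H (k g1)" by (rule identity_hom_image[OF G(3) _ kom]) (simp_all add: im)
  have apB: "is_aperiodic B"
  proof (rule aperiodicI[OF SB])
    fix b assume "b \<in> carrier B"
    then obtain a where a: "a \<in> carrier A" "b = h a" unfolding im by blast
    let ?n = "Suc (card (carrier A))"
    have "h (sg_pow A a (Suc ?n)) = h (sg_pow A a ?n)"
      using aperiodic_sg_pow_stable[OF A(1-3) a(1), of ?n] by simp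
    then have "sg_pow B b (Suc ?n) = sg_pow B b ?n"
      unfolding a(2) using sg_pow_hom[where h = h and R = B, OF A(1) a(1) hom] by metis
    then show "\<exists>n>0. sg_pow B b (Suc n) = sg_pow B b n" by blast
  qed
  have grH: "is_group H"
  proof (rule is_groupI[OF SH eH])
    fix x assume "x \<in> carrier H"
    then obtain g where g: "g \<in> carrier G" "x = k g" unfolding im by blast
    obtain e' where gr: "group \<lparr>carrier = carrier G, monoid.mult = sg_mult G, one = e'\<rparr>" (is "group ?G")
      using G(1) unfolding is_group_def by blast
    interpret group ?G by (rule gr)
    have e': "e' = g1" using G(3) one_closed r_one[of g1] unfolding is_identity_def by simp
    obtain g' where "g' \<in> carrier G" "g' \<star>\<^bsub>G\<^esub> g = g1" using l_inv_ex[of g] g(1) e' by auto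
    then have "k g' \<in> carrier H" "k g' \<star>\<^bsub>H\<^esub> x = k g1"
      unfolding im g(2) using kom[of g' g] g(1) by auto
    then show "\<exists>y\<in>carrier H. y \<star>\<^bsub>H\<^esub> x = k g1" by blast
  qed
  let ?HT = "regular_tsg H \<wr> T" and ?P = "regular_tsg B \<wr> regular_tsg H \<wr> T"
  have pB: "points (regular_tsg B) = Some ` h ` carrier A"
    and pH: "points (regular_tsg H) = Some ` k ` carrier G"
    using regular_tsg_points[OF eB] regular_tsg_points[OF eH] unfolding im by simp_all
  have a1: "a1 \<in> carrier A" and g1: "g1 \<in> carrier G" using A(4) G(3) unfolding is_identity_def by auto
  have tsgHT: "is_tsg ?HT" by (rule is_tsg_wreath[OF is_tsg_regular[OF SH] T(2)]) (use pH g1 in auto)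
  have tsgP: "is_tsg ?P" by (rule is_tsg_wreath[OF is_tsg_regular[OF SB] tsgHT]) (use pB a1 in auto)
  have finP: "finite (points ?P)" "finite (carrier (sem ?P))"
    using A(2) G(2) T(3,4) by (auto simp: pB pH im intro!: finite_PiE)
  obtain T' :: "(nat, nat) tsg" where T': "tsg_iso ?P T'" using ex_nat_copy[OF finP] by blast
  have krT': "kr_product (Suc n) T'"
    by (rule kr_product.step[OF T(1) grH _ SB _ apB T']) (use A(2) G(2) im in auto)
  define h' where "h' = inv_into (carrier A) h"
  define k' where "k' = inv_into (carrier G) k"
  have h': "h' (h a) = a" if "a \<in> carrier A" for a
    unfolding h'_def using that h by (simp add: bij_betw_def)
  have k': "k' (k g) = g" if "g \<in> carrier G" for g
    unfolding k'_def using that k by (simp add: bij_betw_def)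
  define dP where "dP = (\<lambda>(x, y, z). (h' (the x), k' (the y), d z))"
  have "covers ?P S e (\<lambda>z. Q' (dP z))"
    unfolding covers_def
  proof (intro conjI ballI)
    obtain z where "z \<in> points T" "Q (d z) e" using covT unfolding covers_def by blast
    then show "\<exists>z\<in>points ?P. Q' (dP z) e"
      by (intro bexI[of _ "(Some (h a1), Some (k g1), z)"]) (auto simp: dP_def h' k' a1 g1 init pB pH)
  next
    fix s assume s: "s \<in> carrier S"
    obtain t where t: "t \<in> carrier (sem T)"
      and tl: "\<And>z r. z \<in> points T \<Longrightarrow> r \<in> carrier S \<Longrightarrow> Q (d z) r \<Longrightarrow> Q (d (act T z t)) (r \<star>\<^bsub>S\<^esub> s)"
      using covT s unfolding covers_def by blast
    obtain \<gamma> \<alpha> where \<gamma>: "\<And>q. \<gamma> q \<in> carrier G" and \<alpha>: "\<And>g q. \<alpha> g q \<in> carrier A"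
      and up: "\<And>a g q q' r. a \<in> carrier A \<Longrightarrow> g \<in> carrier G \<Longrightarrow> r \<in> carrier S \<Longrightarrow> Q' (a, g, q) r \<Longrightarrow>
           Q q' (r \<star>\<^bsub>S\<^esub> s) \<Longrightarrow> Q' (a \<star>\<^bsub>A\<^esub> \<alpha> g q, g \<star>\<^bsub>G\<^esub> \<gamma> q, q') (r \<star>\<^bsub>S\<^esub> s)"
      using lift[OF s] by blast
    define p where "p = (\<lambda>(y, z)\<in>points ?HT. h (\<alpha> (k' (the y)) (d z)), (\<lambda>z\<in>points T. k (\<gamma> (d z)), t))"
    have p: "p \<in> carrier (sem ?P)"
      unfolding p_def by (auto simp: im \<gamma> \<alpha> t)
    show "\<exists>p\<in>carrier (sem ?P). \<forall>z\<in>points ?P. \<forall>r\<in>carrier S.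
        Q' (dP z) r \<longrightarrow> Q' (dP (act ?P z p)) (r \<star>\<^bsub>S\<^esub> s)"
    proof (intro bexI[OF _ p] ballI impI)
      fix w r assume w: "w \<in> points ?P" and r: "r \<in> carrier S" and Q': "Q' (dP w) r"
      obtain a g z where wz: "w = (Some (h a), Some (k g), z)" "a \<in> carrier A" "g \<in> carrier G" "z \<in> points T"
        using w by (auto simp: pB pH)
      have Q1: "Q' (a, g, d z) r" using Q' wz by (simp add: dP_def h' k')
      have "act ?P w p = (Some (h a \<star>\<^bsub>B\<^esub> h (\<alpha> g (d z))), Some (k g \<star>\<^bsub>H\<^esub> k (\<gamma> (d z))), act T z t)"
        using wz by (simp add: p_def pH k')
      also have "dP \<dots> = (a \<star>\<^bsub>A\<^esub> \<alpha> g (d z), g \<star>\<^bsub>G\<^esub> \<gamma> (d z), d (act T z t))"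
        using wz by (simp add: dP_def hom[symmetric] kom[symmetric] \<alpha> \<gamma> h' k'
            semigroup_closed[OF A(1)] semigroup_closed[OF SG])
      finally show "Q' (dP (act ?P w p)) (r \<star>\<^bsub>S\<^esub> s)"
        using up[OF wz(2,3) r Q1 tl[OF wz(4) r lower[OF Q1]]] by simp
    qed
  qed
  then have "\<exists>d'. covers T' S e (\<lambda>z. Q' (dP (d' z)))" by (rule covers_iso[OF tsgP _ T'])
  then obtain d' where "covers T' S e (\<lambda>z. Q' (dP (d' z)))" ..
  moreover have "is_tsg T'" by (rule tsg_iso_is_tsg[OF tsgP T'])
  ultimately show ?thesis
    unfolding kr_covers_def using krT' tsg_iso_finite[OF T' finP] by (metis comp_apply)
qed

section \<open>Groups and aperiodic monoids that serve as factors\<close>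

lemma extend_to_permutation:
  assumes X: "finite X" and D: "D \<subseteq> X" and g: "inj_on g D" "g ` D \<subseteq> X"
  shows "\<exists>p. p permutes X \<and> (\<forall>x\<in>D. p x = g x)"
proof -
  have fin: "finite D" "finite (X - D)" "finite (X - g ` D)" using X D finite_subset by auto
  have "card (X - D) = card (X - g ` D)"
    using fin D g by (simp add: card_Diff_subset card_image)
  then obtain k where k: "bij_betw k (X - D) (X - g ` D)"
    using fin finite_same_card_bij by blast
  let ?p = "\<lambda>x. if x \<in> D then g x else if x \<in> X then k x else x"
  have "bij_betw ?p (D \<union> (X - D)) (g ` D \<union> (X - g ` D))"
  proof (rule bij_betw_combine)
    show "bij_betw ?p D (g ` D)" using g(1) by (simp add: bij_betw_def inj_on_def)
    show "bij_betw ?p (X - D) (X - g ` D)" by (rule bij_betw_cong[THEN iffD1, OF _ k]) auto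
  qed auto
  moreover have "D \<union> (X - D) = X" "g ` D \<union> (X - g ` D) = X" using D g(2) by auto
  ultimately have "bij_betw ?p X X" by simp
  then have "?p permutes X" by (rule bij_imp_permutes) (use D in auto)
  then show ?thesis by (intro exI[of _ ?p]) auto
qed

text \<open>Permutations compose from left to right, in accordance with the right actions.\<close>

definition perm_group :: "'x set \<Rightarrow> ('x \<Rightarrow> 'x) sgrp" where
  "perm_group X = \<lparr>carrier = {p. p permutes X}, sg_mult = \<lambda>p q. q \<circ> p\<rparr>"

lemma perm_group_simps [simp]:
  "p \<in> carrier (perm_group X) \<longleftrightarrow> p permutes X"
  "p \<star>\<^bsub>perm_group X\<^esub> q = q \<circ> p"
  by (simp_all add: perm_group_def)

lemma is_identity_perm_group: "is_identity (perm_group X) id"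
  by (simp add: is_identity_def permutes_id)

lemma is_group_perm_group: "is_group (perm_group X)"
proof (rule is_groupI[OF _ is_identity_perm_group])
  show "is_semigroup (perm_group X)"
    unfolding is_semigroup_def
  proof (intro conjI)
    show "carrier (perm_group X) \<noteq> {}" by (auto simp: perm_group_def intro: exI[of _ id] permutes_id)
  qed (auto simp: permutes_compose comp_assoc)
  show "\<exists>q\<in>carrier (perm_group X). q \<star>\<^bsub>perm_group X\<^esub> p = id" if "p \<in> carrier (perm_group X)" for p
    using that by (intro bexI[of _ "inv_into UNIV p"]) (auto simp: permutes_inv permutes_inv_o)
qed

lemma finite_perm_group: "finite X \<Longrightarrow> finite (carrier (perm_group X))"
  by (simp add: perm_group_def finite_permutations)

text \<open>A memory with one bit for each element of \<open>X\<close>: an element overwrites the bits in its domain and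
  leaves the others alone. It is a band, hence aperiodic.\<close>

definition override_monoid :: "'x set \<Rightarrow> ('x \<rightharpoonup> bool) sgrp" where
  "override_monoid X = \<lparr>carrier = {m. dom m \<subseteq> X}, sg_mult = (++)\<rparr>"

lemma override_monoid_simps [simp]:
  "m \<in> carrier (override_monoid X) \<longleftrightarrow> dom m \<subseteq> X"
  "m \<star>\<^bsub>override_monoid X\<^esub> n = m ++ n"
  by (simp_all add: override_monoid_def)

lemma is_identity_override_monoid: "is_identity (override_monoid X) Map.empty"
  by (simp add: is_identity_def)

lemma is_semigroup_override_monoid: "is_semigroup (override_monoid X)"
  using is_identity_override_monoid[of X] unfolding is_semigroup_def is_identity_def by auto

lemma is_aperiodic_override_monoid: "is_aperiodic (override_monoid X)"
proof (rule aperiodicI[OF is_semigroup_override_monoid])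
  have "m ++ m = m" for m :: "'a \<rightharpoonup> bool"
    by (rule ext) (simp add: map_add_def split: option.split)
  then show "\<exists>n>0. sg_pow (override_monoid X) m (Suc n) = sg_pow (override_monoid X) m n" for m
    by (intro exI[of _ "Suc 0"]) simp
qed

lemma finite_partial_maps:
  assumes "finite X" "finite Y"
  shows "finite {m :: 'x \<rightharpoonup> 'y. dom m \<subseteq> X \<and> ran m \<subseteq> Y}"
proof -
  have "{m :: 'x \<rightharpoonup> 'y. dom m \<subseteq> X \<and> ran m \<subseteq> Y}
      = (\<Union>D\<in>Pow X. {m. dom m = D \<and> ran m \<subseteq> Y})" by auto
  also have "finite \<dots>"
    using assms by (auto intro!: finite_set_of_finite_maps intro: finite_subset)
  finally show ?thesis .
qed

lemma finite_override_monoid: "finite X \<Longrightarrow> finite (carrier (override_monoid X))"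
  using finite_partial_maps[of X "UNIV :: bool set"] by (simp add: override_monoid_def)

text \<open>Being the identity off \<open>Y\<close> makes the
  monoid finite and lets it compose as ordinary functions.\<close>

definition descending_monoid :: "'y set \<Rightarrow> ('y \<Rightarrow> nat) \<Rightarrow> ('y \<Rightarrow> 'y) sgrp" where
  "descending_monoid Y \<rho> =
     \<lparr>carrier = {\<tau>. (\<forall>y\<in>Y. \<tau> y \<in> Y \<and> (\<tau> y = y \<or> \<rho> (\<tau> y) < \<rho> y)) \<and> (\<forall>y. y \<notin> Y \<longrightarrow> \<tau> y = y)},
      sg_mult = \<lambda>\<tau> \<sigma>. \<sigma> \<circ> \<tau>\<rparr>"

lemma descending_monoid_mult [simp]: "\<tau> \<star>\<^bsub>descending_monoid Y \<rho>\<^esub> \<sigma> = \<sigma> \<circ> \<tau>"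
  by (simp add: descending_monoid_def)

lemma is_identity_descending_monoid: "is_identity (descending_monoid Y \<rho>) id"
  by (simp add: is_identity_def descending_monoid_def)

lemma is_semigroup_descending_monoid: "is_semigroup (descending_monoid Y \<rho>)"
proof -
  have "\<sigma> \<circ> \<tau> \<in> carrier (descending_monoid Y \<rho>)"
    if "\<tau> \<in> carrier (descending_monoid Y \<rho>)" "\<sigma> \<in> carrier (descending_monoid Y \<rho>)" for \<sigma> \<tau>
    using that unfolding descending_monoid_def by (force dest: less_trans)
  then show ?thesis
    using is_identity_descending_monoid[of Y \<rho>]
    unfolding is_semigroup_def is_identity_def by (auto simp: comp_assoc)
qed

lemma finite_descending_monoid:
  assumes "finite Y"
  shows "finite (carrier (descending_monoid Y \<rho>))"
proof (rule finite_subset)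
  show "carrier (descending_monoid Y \<rho>) \<subseteq> (\<lambda>f y. if y \<in> Y then f y else y) ` (Y \<rightarrow>\<^sub>E Y)"
  proof
    fix \<tau> assume "\<tau> \<in> carrier (descending_monoid Y \<rho>)"
    then show "\<tau> \<in> (\<lambda>f y. if y \<in> Y then f y else y) ` (Y \<rightarrow>\<^sub>E Y)"
      by (intro image_eqI[of _ _ "restrict \<tau> Y"]) (auto simp: descending_monoid_def)
  qed
qed (use assms in \<open>auto intro: finite_PiE\<close>)

text \<open>A point of rank \<open>k\<close> can be moved at most \<open>k\<close> times, so the powers of an element become constant.\<close>

lemma is_aperiodic_descending_monoid:
  assumes fin: "finite Y"
  shows "is_aperiodic (descending_monoid Y \<rho>)"
proof (rule aperiodicI[OF is_semigroup_descending_monoid])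
  fix \<tau> assume \<tau>: "\<tau> \<in> carrier (descending_monoid Y \<rho>)"
  have pow: "sg_pow (descending_monoid Y \<rho>) \<tau> n = \<tau> ^^ n" if "n > 0" for n
    using that by (induction n rule: nat_induct_non_zero) simp_all
  have stable: "\<tau> ((\<tau> ^^ k) y) = (\<tau> ^^ k) y" if "y \<in> Y" "\<rho> y \<le> k" for k y
    using that
  proof (induction k arbitrary: y)
    case 0
    then show ?case using \<tau> by (auto simp: descending_monoid_def)
  next
    case (Suc k)
    show ?case
    proof (cases "\<tau> y = y")
      case True
      then have "(\<tau> ^^ n) y = y" for n by (induction n) simp_all
      then show ?thesis using True by simp
    next
      case False
      then have "\<tau> y \<in> Y" "\<rho> (\<tau> y) \<le> k" using \<tau> Suc.prems by (auto simp: descending_monoid_def)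
      from Suc.IH[OF this] show ?thesis by (simp add: funpow_swap1)
    qed
  qed
  define k where "k = Suc (Max (\<rho> ` Y))"
  have "\<tau> ^^ Suc k = \<tau> ^^ k"
  proof
    fix y
    show "(\<tau> ^^ Suc k) y = (\<tau> ^^ k) y"
    proof (cases "y \<in> Y")
      case True
      then have "\<rho> y \<le> k" unfolding k_def using fin by (simp add: le_SucI)
      with True stable show ?thesis by simp
    next
      case False
      then have "\<tau> y = y" using \<tau> by (simp add: descending_monoid_def)
      then have "(\<tau> ^^ n) y = y" for n by (induction n) simp_all
      then show ?thesis by metis
    qed
  qed
  then show "\<exists>n>0. sg_pow (descending_monoid Y \<rho>) \<tau> (Suc n) = sg_pow (descending_monoid Y \<rho>) \<tau> n"
    using pow[of k] pow[of "Suc k"] by (intro exI[of _ k]) (simp_all add: k_def)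
qed

section \<open>Following edges: the lower level\<close>

abbreviation vertex_id :: "'v graph \<Rightarrow> 'v \<rightharpoonup> 'v" where
  "vertex_id \<Gamma> \<equiv> \<lambda>v. if v \<in> fst \<Gamma> then Some v else None"

lemma MR_simps [simp]: "f \<star>\<^bsub>MR \<Gamma>\<^esub> g = g \<circ>\<^sub>m f"
  by (simp add: MR_def)

definition darts :: "'v graph \<Rightarrow> ('v \<times> 'v) set" where
  "darts \<Gamma> = {(a, b). {a, b} \<in> snd \<Gamma>}"

lemma darts_sym: "(a, b) \<in> darts \<Gamma> \<Longrightarrow> (b, a) \<in> darts \<Gamma>"
  by (simp add: darts_def insert_commute)

locale simple_graph =
  fixes \<Gamma> :: "'v graph"
  assumes simple: "is_finite_simple_graph \<Gamma>"
begin

lemma finite_vertices: "finite (fst \<Gamma>)"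
  using simple by (simp add: is_finite_simple_graph_def)

lemma dartD:
  assumes "(a, b) \<in> darts \<Gamma>"
  shows "a \<noteq> b" "a \<in> fst \<Gamma>" "b \<in> fst \<Gamma>"
  using assms simple unfolding darts_def is_finite_simple_graph_def by (auto simp: card_insert_if)

lemma finite_darts: "finite (darts \<Gamma>)"
  by (rule finite_subset[of _ "fst \<Gamma> \<times> fst \<Gamma>"]) (auto dest: dartD simp: finite_vertices)

lemma MR_ran: "f \<in> carrier (MR \<Gamma>) \<Longrightarrow> f a = Some x \<Longrightarrow> x \<in> fst \<Gamma>"
  by (auto simp: MR_def ran_def)

lemma MR_dom: "f \<in> carrier (MR \<Gamma>) \<Longrightarrow> f a = Some x \<Longrightarrow> a \<in> fst \<Gamma>"
  by (auto simp: MR_def dom_def)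

lemma MR_simplex_fibre:
  assumes f: "f \<in> carrier (MR \<Gamma>)" and \<sigma>: "\<sigma> \<in> simplices \<Gamma>"
    and u: "u \<in> preimage f \<sigma>" and v: "v \<in> preimage f \<sigma>" and "u \<noteq> v"
  shows "(u, v) \<in> darts \<Gamma> \<and> preimage f \<sigma> = {u, v}"
proof -
  have "preimage f \<sigma> \<in> simplices \<Gamma>" using f \<sigma> u by (auto simp: MR_def)
  then have e: "preimage f \<sigma> \<in> snd \<Gamma>" using u v \<open>u \<noteq> v\<close> by (auto simp: simplices_def)
  then have c: "card (preimage f \<sigma>) = 2" using simple by (simp add: is_finite_simple_graph_def)
  then have "preimage f \<sigma> = {u, v}" using u v \<open>u \<noteq> v\<close>
    by (metis card_2_iff doubleton_eq_iff insertE singletonD)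
  then show ?thesis using e by (simp add: darts_def)
qed

lemma MR_vertex_fibre:
  assumes "f \<in> carrier (MR \<Gamma>)" "f u = Some w" "f v = Some w" "u \<noteq> v"
  shows "(u, v) \<in> darts \<Gamma>" "f z = Some w \<Longrightarrow> z = u \<or> z = v"
proof -
  have "{w} \<in> simplices \<Gamma>" using MR_ran[OF assms(1,2)] by (auto simp: simplices_def)
  from MR_simplex_fibre[OF assms(1) this, of u v]
  have *: "(u, v) \<in> darts \<Gamma>" "preimage f {w} = {u, v}" using assms by (auto simp: preimage_def)
  show "(u, v) \<in> darts \<Gamma>" by (rule *)
  show "z = u \<or> z = v" if "f z = Some w" using *(2) that by (auto simp: preimage_def)
qed

text \<open>If both ends of an edge are in the image of \<open>f\<close>, they have one preimage each, and these two are
  adjacent: a preimage of the edge with a third point would not be a simplex. So \<open>f\<close> acts on directed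
  edges as a partial injection, and an edge never arises from a non-edge.\<close>

lemma MR_dart_fibre:
  assumes "f \<in> carrier (MR \<Gamma>)" "f u = Some x" "f v = Some y" "(x, y) \<in> darts \<Gamma>"
  shows "(u, v) \<in> darts \<Gamma>" "f z = Some x \<Longrightarrow> z = u" "f z = Some y \<Longrightarrow> z = v"
proof -
  have "{x, y} \<in> simplices \<Gamma>" using assms(4) by (auto simp: simplices_def darts_def)
  moreover have xy: "x \<noteq> y" using dartD assms(4) by blast
  then have "u \<noteq> v" using assms by auto
  ultimately have *: "(u, v) \<in> darts \<Gamma>" "preimage f {x, y} = {u, v}"
    using MR_simplex_fibre[OF assms(1), of "{x, y}" u v] assms by (auto simp: preimage_def)
  show "(u, v) \<in> darts \<Gamma>" by (rule *)
  have "z = u \<or> z = v" if "f z = Some x \<or> f z = Some y"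
    using *(2) that by (auto simp: preimage_def)
  then show "f z = Some x \<Longrightarrow> z = u" "f z = Some y \<Longrightarrow> z = v"
    using assms(2,3) xy by auto
qed

text \<open>\<open>K\<close> is a sound set of flags for the product \<open>r\<close>: a flag on \<open>(a, b)\<close> asserts that \<open>a\<close> is not in the
  image, and the absence of flags on both directions asserts that both ends are in the image.\<close>

definition tracks :: "('v \<times> 'v \<Rightarrow> bool) \<Rightarrow> ('v \<rightharpoonup> 'v) \<Rightarrow> bool" where
  "tracks K r \<longleftrightarrow> (\<forall>(a, b)\<in>darts \<Gamma>. (K (a, b) \<longrightarrow> a \<notin> ran r) \<and>
      (K (a, b) \<or> K (b, a) \<or> (a \<in> ran r \<and> b \<in> ran r)))"

lemma ran_comp: "x \<in> ran (f \<circ>\<^sub>m r) \<longleftrightarrow> (\<exists>c\<in>ran r. f c = Some x)"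
  by (auto simp: ran_def map_comp_def split: option.splits)

definition kept_darts :: "('v \<rightharpoonup> 'v) \<Rightarrow> ('v \<times> 'v) set" where
  "kept_darts f = {(a, b). \<exists>x y. f a = Some x \<and> f b = Some y \<and> (x, y) \<in> darts \<Gamma>}"

definition move_dart :: "('v \<rightharpoonup> 'v) \<Rightarrow> 'v \<times> 'v \<Rightarrow> 'v \<times> 'v" where
  "move_dart f = (\<lambda>(a, b). (the (f a), the (f b)))"

lemma dart_permutation:
  assumes f: "f \<in> carrier (MR \<Gamma>)"
  shows "\<exists>p. p permutes darts \<Gamma> \<and> (\<forall>z\<in>kept_darts f. p z = move_dart f z)"
proof (rule extend_to_permutation)
  show "kept_darts f \<subseteq> darts \<Gamma>" using MR_dart_fibre(1)[OF f] by (auto simp: kept_darts_def)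
  show "inj_on (move_dart f) (kept_darts f)"
    by (rule inj_onI) (auto simp: kept_darts_def move_dart_def dest: MR_dart_fibre(2,3)[OF f])
qed (auto simp: finite_darts kept_darts_def move_dart_def)

text \<open>A flag travels with a directed edge that \<open>f\<close> keeps: by \<open>MR_dart_fibre\<close> the end \<open>x\<close> of the new edge has
  the corresponding end of the old edge as its only preimage. On an edge that is not the image of an edge,
  at most one end is in the image of \<open>f\<close>, so flags that depend on \<open>f\<close> alone are sound.\<close>

lemma tracks_step:
  assumes f: "f \<in> carrier (MR \<Gamma>)" and K: "tracks K r"
    and kept: "\<And>z. z \<in> kept_darts f \<Longrightarrow> K' (move_dart f z) = K z"
    and new: "\<And>x y. (x, y) \<in> darts \<Gamma> \<Longrightarrow> (x, y) \<notin> move_dart f ` kept_darts f \<Longrightarrow>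
        K' (x, y) \<longleftrightarrow> x \<notin> ran f"
  shows "tracks K' (f \<circ>\<^sub>m r)"
proof -
  have "(K' (x, y) \<longrightarrow> x \<notin> ran (f \<circ>\<^sub>m r)) \<and>
      (K' (x, y) \<or> K' (y, x) \<or> (x \<in> ran (f \<circ>\<^sub>m r) \<and> y \<in> ran (f \<circ>\<^sub>m r)))"
    if xy: "(x, y) \<in> darts \<Gamma>" for x y
  proof (cases "(x, y) \<in> move_dart f ` kept_darts f")
    case True
    then obtain a b where ab: "f a = Some x" "f b = Some y"
      by (auto simp: kept_darts_def move_dart_def)
    then have "(a, b) \<in> kept_darts f" "(b, a) \<in> kept_darts f"
      using xy darts_sym[OF xy] by (auto simp: kept_darts_def)
    from kept[OF this(1)] kept[OF this(2)]
    have K': "K' (x, y) = K (a, b)" "K' (y, x) = K (b, a)" using ab by (simp_all add: move_dart_def)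
    note fib = MR_dart_fibre[OF f ab xy]
    have "x \<in> ran (f \<circ>\<^sub>m r) \<longleftrightarrow> a \<in> ran r" "y \<in> ran (f \<circ>\<^sub>m r) \<longleftrightarrow> b \<in> ran r"
      using fib(2,3) ab unfolding ran_comp by blast+
    then show ?thesis using K fib(1) unfolding tracks_def K' by blast
  next
    case False
    have "(y, x) \<notin> move_dart f ` kept_darts f"
    proof
      assume "(y, x) \<in> move_dart f ` kept_darts f"
      then obtain a b where "f a = Some x" "f b = Some y"
        by (auto simp: kept_darts_def move_dart_def)
      then have "(x, y) \<in> move_dart f ` kept_darts f"
        using xy by (intro image_eqI[of _ _ "(a, b)"]) (auto simp: kept_darts_def move_dart_def)
      with False show False ..
    qed
    with False have K': "K' (x, y) \<longleftrightarrow> x \<notin> ran f" "K' (y, x) \<longleftrightarrow> y \<notin> ran f"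
      using new[OF xy] new[OF darts_sym[OF xy]] by blast+
    have "x \<notin> ran f \<or> y \<notin> ran f"
    proof (rule ccontr)
      assume "\<not> ?thesis"
      then obtain a b where "f a = Some x" "f b = Some y" by (auto simp: ran_def)
      then have "(x, y) \<in> move_dart f ` kept_darts f"
        using xy by (intro image_eqI[of _ _ "(a, b)"]) (auto simp: kept_darts_def move_dart_def)
      with False show False ..
    qed
    moreover have "x \<in> ran f" if "x \<in> ran (f \<circ>\<^sub>m r)" using that by (auto simp: ran_comp ranI)
    ultimately show ?thesis using K' by blast
  qed
  then show ?thesis unfolding tracks_def by blast
qed

text \<open>The memory is indexed by names, the original positions of directed edges; \<open>\<gamma>\<close> sends a name to its
  current position.\<close>

definition dart_flags :: "('v \<times> 'v \<rightharpoonup> bool) \<times> ('v \<times> 'v \<Rightarrow> 'v \<times> 'v) \<times> 'q \<Rightarrow> 'v \<times> 'v \<Rightarrow> bool" where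
  "dart_flags = (\<lambda>(\<kappa>, \<gamma>, q) z. \<kappa> (inv_into UNIV \<gamma> z) = Some True)"

text \<open>In terms of names, transporting the flags along kept edges changes nothing in the memory, and the
  other flags are set to constants. So each map acts on the memory by overriding.\<close>

lemma kr_covers_darts:
  "kr_covers 1 (MR \<Gamma>) (vertex_id \<Gamma>)
     (\<lambda>z :: _ \<times> _ \<times> nat. tracks (dart_flags z))"
proof -
  have "kr_covers (Suc 0) (MR \<Gamma>) (vertex_id \<Gamma>) (\<lambda>z :: _ \<times> _ \<times> nat. tracks (dart_flags z))"
  proof (rule kr_covers_Suc[OF kr_covers_0 is_semigroup_override_monoid
        finite_override_monoid[OF finite_darts] is_aperiodic_override_monoid
        is_identity_override_monoid is_group_perm_group finite_perm_group[OF finite_darts]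
        is_identity_perm_group])
    have "tracks (\<lambda>_. False) (vertex_id \<Gamma>)" by (auto simp: tracks_def ran_def dest: dartD)
    then show "tracks (dart_flags (Map.empty, id, q)) (vertex_id \<Gamma>)" for q :: nat
      by (simp add: dart_flags_def)
  next
    fix f assume f: "f \<in> carrier (MR \<Gamma>)"
    obtain p where p: "p permutes darts \<Gamma>" and pf: "\<And>z. z \<in> kept_darts f \<Longrightarrow> p z = move_dart f z"
      using dart_permutation[OF f] by blast
    define \<alpha> where "\<alpha> \<gamma> = (\<lambda>n. if n \<notin> darts \<Gamma> \<or> p (\<gamma> n) \<in> move_dart f ` kept_darts f then None
        else Some (fst (p (\<gamma> n)) \<notin> ran f))" for \<gamma> :: "'v \<times> 'v \<Rightarrow> 'v \<times> 'v"
    have "dom (\<alpha> \<gamma>) \<subseteq> darts \<Gamma>" for \<gamma> by (auto simp: \<alpha>_def split: if_splits)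
    moreover have "tracks (dart_flags (\<kappa> ++ \<alpha> \<gamma>, p \<circ> \<gamma>, q')) (f \<circ>\<^sub>m r)"
      if \<gamma>: "\<gamma> permutes darts \<Gamma>" and K: "tracks (dart_flags (\<kappa>, \<gamma>, q)) r" for \<kappa> \<gamma> r and q q' :: nat
    proof (rule tracks_step[OF f K])
      have inv: "inv_into UNIV (p \<circ> \<gamma>) z = inv_into UNIV \<gamma> (inv_into UNIV p z)" for z
        using p \<gamma> by (simp add: o_inv_distrib permutes_bij)
      have undo: "p (\<gamma> (inv_into UNIV (p \<circ> \<gamma>) z)) = z" for z
        unfolding inv using p \<gamma> by (simp add: permutes_inverses)
      show "dart_flags (\<kappa> ++ \<alpha> \<gamma>, p \<circ> \<gamma>, q') (move_dart f z) = dart_flags (\<kappa>, \<gamma>, q) z"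
        if z: "z \<in> kept_darts f" for z
      proof -
        have "inv_into UNIV p (move_dart f z) = z" using pf[OF z] p by (metis permutes_inverses(2))
        then have i: "inv_into UNIV (p \<circ> \<gamma>) (move_dart f z) = inv_into UNIV \<gamma> z" by (simp add: inv)
        have "\<alpha> \<gamma> (inv_into UNIV \<gamma> z) = None" unfolding \<alpha>_def using z \<gamma> pf[OF z]
          by (simp add: permutes_inverses)
        then show ?thesis unfolding dart_flags_def prod.case i by (simp add: map_add_def)
      qed
      show "dart_flags (\<kappa> ++ \<alpha> \<gamma>, p \<circ> \<gamma>, q') (x, y) \<longleftrightarrow> x \<notin> ran f"
        if xy: "(x, y) \<in> darts \<Gamma>" "(x, y) \<notin> move_dart f ` kept_darts f" for x y
      proof -
        have "inv_into UNIV (p \<circ> \<gamma>) (x, y) \<in> darts \<Gamma>"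
          using permutes_in_image[OF permutes_inv[OF permutes_compose[OF \<gamma> p]]] xy(1) by blast
        then have "\<alpha> \<gamma> (inv_into UNIV (p \<circ> \<gamma>) (x, y)) = Some (x \<notin> ran f)"
          using xy undo[of "(x, y)"] by (simp add: \<alpha>_def)
        then show ?thesis by (simp add: dart_flags_def map_add_def)
      qed
    qed
    ultimately show "\<exists>\<gamma> \<alpha>. (\<forall>q::nat. \<gamma> q \<in> carrier (perm_group (darts \<Gamma>))) \<and>
        (\<forall>g q. \<alpha> g q \<in> carrier (override_monoid (darts \<Gamma>))) \<and>
        (\<forall>a g q (q' :: nat) r. a \<in> carrier (override_monoid (darts \<Gamma>)) \<longrightarrow>
          g \<in> carrier (perm_group (darts \<Gamma>)) \<longrightarrow> r \<in> carrier (MR \<Gamma>) \<longrightarrow>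
          tracks (dart_flags (a, g, q)) r \<longrightarrow> True \<longrightarrow>
          tracks (dart_flags (a \<star>\<^bsub>override_monoid (darts \<Gamma>)\<^esub> \<alpha> g q,
              g \<star>\<^bsub>perm_group (darts \<Gamma>)\<^esub> \<gamma> q, q')) (r \<star>\<^bsub>MR \<Gamma>\<^esub> f))"
      using p unfolding perm_group_simps override_monoid_simps MR_simps
      by (intro exI[of _ "\<lambda>_. p"] exI[of _ "\<lambda>\<gamma> _. \<alpha> \<gamma>"]) blast
  qed (rule TrueI)
  then show ?thesis unfolding One_nat_def .
qed

section \<open>Following vertices: the upper level\<close>

text \<open>A choice of one preimage of \<open>w\<close> that avoids a flagged point if the other preimage is not flagged. The
  choice depends on the flags but not on the product itself.\<close>

definition representative :: "('v \<times> 'v \<Rightarrow> bool) \<Rightarrow> ('v \<rightharpoonup> 'v) \<Rightarrow> 'v \<Rightarrow> 'v" where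
  "representative K f w =
     (SOME u. f u = Some w \<and> (\<forall>v. f v = Some w \<longrightarrow> v \<noteq> u \<longrightarrow> K (u, v) \<longrightarrow> K (v, u)))"

lemma representative:
  assumes f: "f \<in> carrier (MR \<Gamma>)" and w: "w \<in> ran f"
  shows "f (representative K f w) = Some w"
    "f v = Some w \<Longrightarrow> v \<noteq> representative K f w \<Longrightarrow> K (representative K f w, v) \<Longrightarrow>
       K (v, representative K f w)"
proof -
  let ?P = "\<lambda>u. f u = Some w \<and> (\<forall>v. f v = Some w \<longrightarrow> v \<noteq> u \<longrightarrow> K (u, v) \<longrightarrow> K (v, u))"
  have "\<exists>u. ?P u"
  proof (rule ccontr)
    assume neg: "\<not> ?thesis"
    obtain u where u: "f u = Some w" using w by (auto simp: ran_def)
    then obtain v where v: "f v = Some w" "v \<noteq> u" "K (u, v)" "\<not> K (v, u)" using neg by blast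
    obtain z where z: "f z = Some w" "z \<noteq> v" "K (v, z)" "\<not> K (z, v)" using neg v(1) by blast
    have "z = u" using MR_vertex_fibre(2)[OF f u v(1) v(2)[symmetric] z(1)] z(2) by blast
    with z v show False by blast
  qed
  then have "?P (representative K f w)" unfolding representative_def by (rule someI_ex)
  then show "f (representative K f w) = Some w"
    "f v = Some w \<Longrightarrow> v \<noteq> representative K f w \<Longrightarrow> K (representative K f w, v) \<Longrightarrow>
       K (v, representative K f w)" by blast+
qed

text \<open>A point \<open>v\<close> of the image that is not chosen carries no flag, so neither does the chosen
  point, and then both ends of the edge between them are in the image.\<close>

lemma representative_live:
  assumes f: "f \<in> carrier (MR \<Gamma>)" and K: "tracks K r" and v: "f v = Some w" "v \<in> ran r"
  shows "representative K f w \<in> ran r"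
proof (cases "v = representative K f w")
  case False
  have w: "w \<in> ran f" using v(1) by (rule ranI)
  note c = representative[OF f w, where K = K]
  have d: "(representative K f w, v) \<in> darts \<Gamma>"
    using MR_vertex_fibre(1)[OF f c(1) v(1)] False by metis
  have "\<not> K (v, representative K f w)"
    using bspec[OF K[unfolded tracks_def] darts_sym[OF d]] v(2) by simp
  moreover from this have "\<not> K (representative K f w, v)" using c(2)[OF v(1) False] by metis
  ultimately show ?thesis using bspec[OF K[unfolded tracks_def] d] by simp
qed (use v in simp)

lemma vertex_permutation:
  assumes f: "f \<in> carrier (MR \<Gamma>)"
  shows "\<exists>p. p permutes fst \<Gamma> \<and> (\<forall>w\<in>ran f. p (representative K f w) = w)"
proof -
  note c = representative(1)[OF f]
  have "\<exists>p. p permutes fst \<Gamma> \<and> (\<forall>u\<in>representative K f ` ran f. p u = the (f u))"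
  proof (rule extend_to_permutation[OF finite_vertices])
    show "representative K f ` ran f \<subseteq> fst \<Gamma>" using c MR_dom[OF f] by blast
    show "inj_on (\<lambda>u. the (f u)) (representative K f ` ran f)"
      using c by (auto simp: inj_on_def)
    show "(\<lambda>u. the (f u)) ` representative K f ` ran f \<subseteq> fst \<Gamma>"
      using c MR_ran[OF f] by fastforce
  qed
  then show ?thesis using c by fastforce
qed

definition vertex_maps :: "('v \<rightharpoonup> 'v) set" where
  "vertex_maps = {F. dom F \<subseteq> fst \<Gamma> \<and> ran F \<subseteq> fst \<Gamma>}"

lemma finite_vertex_maps: "finite vertex_maps"
  unfolding vertex_maps_def by (rule finite_partial_maps) (rule finite_vertices)+

text \<open>The name \<open>y\<close> of a point \<open>\<delta> y\<close> is replaced by the name of the representative of its fibre under \<open>f\<close>.\<close>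

definition merge_names ::
  "('v \<times> 'v \<Rightarrow> bool) \<Rightarrow> ('v \<rightharpoonup> 'v) \<Rightarrow> ('v \<Rightarrow> 'v) \<Rightarrow> 'v \<rightharpoonup> 'v" where
  "merge_names K f \<delta> y =
     map_option (\<lambda>w. inv_into UNIV \<delta> (representative K f w)) (f (\<delta> y))"

text \<open>Composition with \<open>g\<close>, except where this would not be descending: the cascade also has states that
  represent no product, and there the value is irrelevant. \<open>collapse_merge_names\<close> shows that the
  exception never occurs in a state that represents a product.\<close>

definition collapse :: "('v \<rightharpoonup> 'v) \<Rightarrow> ('v \<rightharpoonup> 'v) \<Rightarrow> ('v \<rightharpoonup> 'v)" where
  "collapse g F =
     (if F \<in> vertex_maps \<and> g \<circ>\<^sub>m F \<in> vertex_maps \<and> card (ran (g \<circ>\<^sub>m F)) < card (ran F)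
      then g \<circ>\<^sub>m F else F)"

lemma collapse_descending:
  "collapse g \<in> carrier (descending_monoid vertex_maps (\<lambda>F. card (ran F)))"
  by (auto simp: descending_monoid_def collapse_def)

text \<open>The map of names sends names of points in the image of \<open>r\<close> to such names and fixes its values. So it
  either fixes all names in use or strictly decreases their number.\<close>

lemma collapse_merge_names:
  assumes f: "f \<in> carrier (MR \<Gamma>)" and K: "tracks K r"
    and F: "F \<in> vertex_maps" and \<delta>: "\<delta> permutes fst \<Gamma>" and r: "r = map_option \<delta> \<circ> F"
  shows "collapse (merge_names K f \<delta>) F = merge_names K f \<delta> \<circ>\<^sub>m F"
proof -
  let ?g = "merge_names K f \<delta>" and ?c = "representative K f"
  note inv = permutes_inverses[OF \<delta>]
  have g_ran: "z \<in> ran F \<and> ?g z = Some z" if "?g y = Some z" "y \<in> ran F" for y z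
  proof -
    obtain w where w: "f (\<delta> y) = Some w" "z = inv_into UNIV \<delta> (?c w)"
      using \<open>?g y = Some z\<close> by (auto simp: merge_names_def)
    have "\<delta> y \<in> ran r" using \<open>y \<in> ran F\<close> unfolding r ran_def by auto
    from representative_live[OF f K w(1) this] have "?c w \<in> ran r" .
    then obtain a where "r a = Some (?c w)" by (auto simp: ran_def)
    then obtain x where "F a = Some x" "?c w = \<delta> x" unfolding r by auto
    then have x: "x \<in> ran F" "?c w = \<delta> x" by (auto intro: ranI)
    have "f (?c w) = Some w" by (rule representative(1)[OF f]) (rule ranI[of f, OF w(1)])
    then show ?thesis using x w(2) by (simp add: inv merge_names_def)
  qed
  have sub: "ran (?g \<circ>\<^sub>m F) \<subseteq> ran F" using g_ran unfolding ran_comp subset_iff by blast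
  moreover have "dom (?g \<circ>\<^sub>m F) \<subseteq> dom F" by (auto simp: map_comp_def split: option.splits)
  ultimately have gF: "?g \<circ>\<^sub>m F \<in> vertex_maps" using F unfolding vertex_maps_def by auto
  have fin: "finite (ran F)" using F finite_vertices finite_subset unfolding vertex_maps_def by auto
  show ?thesis
  proof (cases "ran (?g \<circ>\<^sub>m F) = ran F")
    case True
    have "?g y = Some y" if "y \<in> ran F" for y
      using that g_ran unfolding True[symmetric] ran_comp[of y] by blast
    then have "?g \<circ>\<^sub>m F = F"
      by (intro ext) (auto simp: map_comp_def ran_def split: option.split)
    then show ?thesis by (simp add: collapse_def)
  next
    case False
    with sub fin have "card (ran (?g \<circ>\<^sub>m F)) < card (ran F)" by (intro psubset_card_mono) auto
    then show ?thesis using F gF by (simp add: collapse_def)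
  qed
qed

text \<open>The product \<open>r\<close> is recovered as \<open>\<delta> \<circ> F\<close>, where \<open>F\<close> is the result of the descending map \<open>\<tau>\<close> on the identity.\<close>

definition encodes ::
  "(('v \<rightharpoonup> 'v) \<Rightarrow> 'v \<rightharpoonup> 'v) \<times> ('v \<Rightarrow> 'v) \<times> ('v \<times> 'v \<rightharpoonup> bool) \<times> ('v \<times> 'v \<Rightarrow> 'v \<times> 'v) \<times> nat \<Rightarrow>
    ('v \<rightharpoonup> 'v) \<Rightarrow> bool" where
  "encodes = (\<lambda>(\<tau>, \<delta>, z) r. tracks (dart_flags z) r \<and> r = map_option \<delta> \<circ> \<tau> (vertex_id \<Gamma>))"

lemma kr_covers_vertices:
  "kr_covers 2 (MR \<Gamma>) (vertex_id \<Gamma>) encodes"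
  (is "kr_covers 2 _ _ ?Q")
proof -
  let ?A = "descending_monoid vertex_maps (\<lambda>F. card (ran F))"
  have "kr_covers (Suc 1) (MR \<Gamma>) (vertex_id \<Gamma>) ?Q"
  proof (rule kr_covers_Suc[OF kr_covers_darts is_semigroup_descending_monoid
        finite_descending_monoid[OF finite_vertex_maps]
        is_aperiodic_descending_monoid[OF finite_vertex_maps]
        is_identity_descending_monoid is_group_perm_group finite_perm_group[OF finite_vertices]
        is_identity_perm_group])
    fix f assume f: "f \<in> carrier (MR \<Gamma>)"
    have "\<forall>K. \<exists>p. p permutes fst \<Gamma> \<and> (\<forall>w\<in>ran f. p (representative K f w) = w)"
      by (intro allI vertex_permutation f)
    then obtain p where
      "\<forall>K. p K permutes fst \<Gamma> \<and> (\<forall>w\<in>ran f. p K (representative K f w) = w)"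
      by (rule choice[THEN exE])
    then have p: "p K permutes fst \<Gamma>"
      and pc: "w \<in> ran f \<Longrightarrow> p K (representative K f w) = w" for K w
      by simp_all
    have step: "f \<circ>\<^sub>m r = map_option (p K \<circ> \<delta>) \<circ> collapse (merge_names K f \<delta>) (\<tau> (vertex_id \<Gamma>))"
      if \<tau>: "\<tau> \<in> carrier ?A" and \<delta>: "\<delta> permutes fst \<Gamma>" and K: "tracks K r"
        and r: "r = map_option \<delta> \<circ> \<tau> (vertex_id \<Gamma>)" for \<tau> \<delta> K r
    proof -
      have "vertex_id \<Gamma> \<in> vertex_maps" by (auto simp: vertex_maps_def ran_def split: if_splits)
      then have F: "\<tau> (vertex_id \<Gamma>) \<in> vertex_maps" using \<tau> by (simp add: descending_monoid_def)
      note eq = collapse_merge_names[OF f K F \<delta> r]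
      show ?thesis
      proof
        fix x
        show "(f \<circ>\<^sub>m r) x = (map_option (p K \<circ> \<delta>) \<circ> collapse (merge_names K f \<delta>) (\<tau> (vertex_id \<Gamma>))) x"
        proof (cases "\<tau> (vertex_id \<Gamma>) x")
          case (Some y)
          then show ?thesis
            by (cases "f (\<delta> y)")
              (simp_all add: eq r merge_names_def permutes_inverses[OF \<delta>] pc ranI[of f])
        qed (simp add: eq r)
      qed
    qed
    show "\<exists>\<gamma> \<alpha>. (\<forall>q. \<gamma> q \<in> carrier (perm_group (fst \<Gamma>))) \<and> (\<forall>g q. \<alpha> g q \<in> carrier ?A) \<and>
        (\<forall>a g q (q' :: _ \<times> _ \<times> nat) r. a \<in> carrier ?A \<longrightarrow> g \<in> carrier (perm_group (fst \<Gamma>)) \<longrightarrow>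
          r \<in> carrier (MR \<Gamma>) \<longrightarrow> ?Q (a, g, q) r \<longrightarrow>
          tracks (dart_flags q') (r \<star>\<^bsub>MR \<Gamma>\<^esub> f) \<longrightarrow>
          ?Q (a \<star>\<^bsub>?A\<^esub> \<alpha> g q, g \<star>\<^bsub>perm_group (fst \<Gamma>)\<^esub> \<gamma> q, q') (r \<star>\<^bsub>MR \<Gamma>\<^esub> f))"
      using p step collapse_descending
      by (intro exI[of _ "\<lambda>q. p (dart_flags q)"]
          exI[of _ "\<lambda>\<delta> q. collapse (merge_names (dart_flags q) f \<delta>)"])
        (simp add: encodes_def)
  next
    show "tracks (dart_flags q) r" if "?Q (a, g, q) r" for a g r and q :: "_ \<times> _ \<times> nat"
      using that unfolding encodes_def prod.case by blast
    show "?Q (id, id, q) (vertex_id \<Gamma>)"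
      if "tracks (dart_flags q) (vertex_id \<Gamma>)" for q :: "_ \<times> _ \<times> nat"
      using that by (simp add: encodes_def option.map_id0)
  qed
  then show ?thesis by (simp add: numeral_2_eq_2)
qed

lemma MR_divides_kr_product_2: "\<exists>T. kr_product 2 T \<and> MR \<Gamma> \<prec> sem T"
proof -
  obtain T d where T: "kr_product 2 T" "is_tsg T"
    and cov: "covers T (MR \<Gamma>) (vertex_id \<Gamma>) (\<lambda>z. encodes (d z))"
    using kr_covers_vertices unfolding kr_covers_def by blast
  have "MR \<Gamma> \<prec> sem T"
    by (rule covers_imp_divides[OF T(2) is_semigroup_MR[OF simple] is_identity_MR[OF simple] cov])
      (auto simp: encodes_def split: prod.splits)
  with T show ?thesis by blast
qed

end

section \<open>An obstruction to complexity one\<close>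

lemma sg_pow_restrict: "sg_pow (S\<lparr>carrier := U\<rparr>) x n = sg_pow S x n"
  by (induction n) simp_all

lemma wreath_mult_components:
  "fst (w \<star>\<^bsub>sem (P \<wr> Q)\<^esub> w') = (\<lambda>y\<in>points Q. fst w y \<star>\<^bsub>sem P\<^esub> fst w' (act Q y (snd w)))"
  "snd (w \<star>\<^bsub>sem (P \<wr> Q)\<^esub> w') = snd w \<star>\<^bsub>sem Q\<^esub> snd w'"
  by (cases w; cases w'; simp)+

lemma sg_divides_iso:
  assumes P: "is_semigroup (sem P)" and div: "S \<prec> sem Q" and iso: "tsg_iso P Q"
  shows "S \<prec> sem P"
proof -
  obtain \<psi> where \<psi>: "bij_betw \<psi> (carrier (sem P)) (carrier (sem Q))"
    and hom: "\<And>s t. s \<in> carrier (sem P) \<Longrightarrow> t \<in> carrier (sem P) \<Longrightarrow>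
           \<psi> (s \<star>\<^bsub>sem P\<^esub> t) = \<psi> s \<star>\<^bsub>sem Q\<^esub> \<psi> t"
    using iso unfolding tsg_iso_def by blast
  obtain U h where U: "is_subsemigroup U (sem Q)" and h: "h ` U = carrier S"
    and hU: "\<forall>x\<in>U. \<forall>y\<in>U. h (x \<star>\<^bsub>sem Q\<^esub> y) = h x \<star>\<^bsub>S\<^esub> h y"
    using div unfolding sg_divides_def by blast
  define V where "V = {p \<in> carrier (sem P). \<psi> p \<in> U}"
  have sub: "U \<subseteq> carrier (sem Q)" "U \<noteq> {}"
    and closed: "\<And>x y. x \<in> U \<Longrightarrow> y \<in> U \<Longrightarrow> x \<star>\<^bsub>sem Q\<^esub> y \<in> U"
    using U unfolding is_subsemigroup_def is_semigroup_def by auto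
  have V: "\<psi> ` V = U" using \<psi> sub unfolding V_def bij_betw_def by auto
  have "is_subsemigroup V (sem P)"
    unfolding is_subsemigroup_def is_semigroup_def
  proof (intro conjI)
    show "carrier (sem P\<lparr>carrier := V\<rparr>) \<noteq> {}" using V sub(2) by auto
  qed (auto simp: V_def hom closed semigroup_closed[OF P] semigroup_assoc[OF P])
  moreover have "(h \<circ> \<psi>) ` V = carrier S" using V h by (metis image_comp)
  moreover have "\<forall>x\<in>V. \<forall>y\<in>V. (h \<circ> \<psi>) (x \<star>\<^bsub>sem P\<^esub> y) = (h \<circ> \<psi>) x \<star>\<^bsub>S\<^esub> (h \<circ> \<psi>) y"
    using hU by (simp add: V_def hom)
  ultimately show ?thesis unfolding sg_divides_def by blast
qed

definition sg_pow_stable :: "'a sgrp \<Rightarrow> nat \<Rightarrow> bool" where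
  "sg_pow_stable S N \<longleftrightarrow> (\<forall>x\<in>carrier S. \<forall>n\<ge>N. sg_pow S x (Suc n) = sg_pow S x n)"

lemma kr_product_0_stable:
  assumes "kr_product 0 T"
  shows "is_tsg T" "\<exists>N. sg_pow_stable (sem T) N"
proof -
  obtain A :: "nat sgrp" where A: "is_semigroup A" "finite (carrier A)" "is_aperiodic A"
    and iso: "tsg_iso (regular_tsg A) T"
    using assms by (cases rule: kr_product.cases) auto
  show "is_tsg T" by (rule tsg_iso_is_tsg[OF is_tsg_regular[OF A(1)] iso])
  obtain \<psi> where \<psi>: "\<psi> ` carrier A = carrier (sem T)"
    and hom: "\<And>s t. s \<in> carrier A \<Longrightarrow> t \<in> carrier A \<Longrightarrow> \<psi> (s \<star>\<^bsub>A\<^esub> t) = \<psi> s \<star>\<^bsub>sem T\<^esub> \<psi> t"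
    using iso unfolding tsg_iso_def by (auto simp: bij_betw_def)
  have "sg_pow (sem T) (\<psi> a) (Suc n) = sg_pow (sem T) (\<psi> a) n"
    if "a \<in> carrier A" "card (carrier A) \<le> n" for a n
    using aperiodic_sg_pow_stable[OF A that]
      sg_pow_hom[where h = \<psi> and R = "sem T", OF A(1) that(1) hom] by metis
  then show "\<exists>N. sg_pow_stable (sem T) N"
    unfolding sg_pow_stable_def \<psi>[symmetric] by blast
qed

lemma group_pow_card:
  assumes G: "is_group G" and fin: "finite (carrier G)" and e: "is_identity G e"
    and g: "g \<in> carrier G" and m: "card (carrier G) dvd m" "m > 0"
  shows "sg_pow G g m = e"
proof -
  obtain e' where gr: "group \<lparr>carrier = carrier G, monoid.mult = sg_mult G, one = e'\<rparr>" (is "group ?G")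
    using G unfolding is_group_def by blast
  interpret group ?G by (rule gr)
  have e': "e' = e" using e one_closed r_one[of e] unfolding is_identity_def by simp
  have pow: "sg_pow G g n = g [^]\<^bsub>?G\<^esub> n" if "n > 0" for n
    using that by (induction n rule: nat_induct_non_zero) (use g l_one[of g] in simp_all)
  obtain k where k: "m = order ?G * k" using m(1) by (auto simp: order_def)
  have "g [^]\<^bsub>?G\<^esub> order ?G = e" using pow_order_eq_1[of g] g e' by simp
  then have "g [^]\<^bsub>?G\<^esub> m = e"
    unfolding k using g e' nat_pow_pow[of g "order ?G" k] nat_pow_one[of k] by simp
  then show ?thesis using pow m(2) by simp
qed

lemma is_group_identity:
  assumes "is_group G"
  obtains e where "is_identity G e"
proof -
  obtain e where gr: "group \<lparr>carrier = carrier G, monoid.mult = sg_mult G, one = e\<rparr>" (is "group ?G")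
    using assms unfolding is_group_def by blast
  interpret group ?G by (rule gr)
  have "is_identity G e" unfolding is_identity_def using one_closed l_one r_one by auto
  then show thesis by (rule that)
qed

text \<open>Think of \<open>M\<close> as related to a group of exponent \<open>m\<close>, and of \<open>K\<close> as the elements of \<open>M\<close> that are
  related to its identity. The power \<open>w\<^sup>m\<^sup>-\<^sup>1\<close> is related to the inverse of what \<open>w\<close> is related to, which
  gives the closure properties below. An element of \<open>M\<close> may be related to several group elements.\<close>

locale identity_related =
  fixes S :: "'s sgrp" and m :: nat and M K :: "'s set"
  assumes M_sub: "M \<subseteq> carrier S" and K_sub: "K \<subseteq> M"
    and M_mult: "v \<in> M \<Longrightarrow> w \<in> M \<Longrightarrow> v \<star>\<^bsub>S\<^esub> w \<in> M"
    and K_mult: "v \<in> K \<Longrightarrow> w \<in> K \<Longrightarrow> v \<star>\<^bsub>S\<^esub> w \<in> K"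
    and K_pow: "w \<in> M \<Longrightarrow> sg_pow S w m \<in> K"
    and K_conj: "w \<in> M \<Longrightarrow> k \<in> K \<Longrightarrow> w \<star>\<^bsub>S\<^esub> k \<star>\<^bsub>S\<^esub> sg_pow S w (m - 1) \<in> K"
    and K_conj': "w \<in> M \<Longrightarrow> k \<in> K \<Longrightarrow> sg_pow S w (m - 1) \<star>\<^bsub>S\<^esub> k \<star>\<^bsub>S\<^esub> w \<in> K"
    and K_return: "w \<in> M \<Longrightarrow> k \<in> K \<Longrightarrow> sg_pow S (w \<star>\<^bsub>S\<^esub> k) (m - 1) \<star>\<^bsub>S\<^esub> w \<in> K"

text \<open>The hypotheses say that \<open>x\<close> generates a cyclic group and that its identity \<open>x\<^sup>d\<close> acts as a right identity on \<open>t\<close>.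
  Replace a lift \<open>x'\<close> of \<open>x\<close> by \<open>X = x'\<^sup>m\<^sup>+\<^sup>1\<close> and a lift \<open>t'\<close> of \<open>t\<close> by \<open>Y = t' x'\<^sup>m\<close>. The
  bottom component of \<open>X\<close> is then the idempotent to which the powers of that of \<open>x'\<close> converge, so
  \<open>c\<close>, the bottom component of \<open>Y\<^sup>m\<close>, is fixed by right multiplication with the bottom components of
  \<open>X\<close> and \<open>Y\<close>. On the bottom states \<open>q c\<close> the group component \<open>\<rho>\<close> is multiplicative. Words on which it is trivial
  fix the states of \<open>G \<wr> A\<^sub>0\<close> over \<open>q c\<close>, and there the top component is multiplicative as well,
  with values in an aperiodic semigroup. All this is visible only after a prefix \<open>Y\<^sup>m\<close>, which moves every
  bottom state to one of the form \<open>q c\<close>.\<close>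

lemma complexity_one_obstruction:
  fixes S :: "'s sgrp"
  assumes kr: "kr_product 1 T'" and div: "S \<prec> sem T'"
    and x: "x \<in> carrier S" "sg_pow S x (Suc d) = x"
    and t: "t \<in> carrier S" "t \<star>\<^bsub>S\<^esub> sg_pow S x d = t" and d: "d > 0"
  shows "\<exists>m M K. m > 1 \<and> d dvd m \<and> x \<in> M \<and> t \<in> M \<and> identity_related S m M K \<and>
    (\<forall>k\<in>K. sg_pow S t m \<star>\<^bsub>S\<^esub> sg_pow S k (Suc m) = sg_pow S t m \<star>\<^bsub>S\<^esub> sg_pow S k m)"
proof -
  obtain T and G A :: "nat sgrp" where T0: "kr_product 0 T"
    and G: "is_group G" "finite (carrier G)"
    and A: "is_semigroup A" "finite (carrier A)" "is_aperiodic A"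
    and iso: "tsg_iso (regular_tsg A \<wr> regular_tsg G \<wr> T) T'"
    using kr by (cases rule: kr_product.cases) auto
  let ?Q = "regular_tsg G \<wr> T" and ?P = "regular_tsg A \<wr> regular_tsg G \<wr> T"
  let ?W = "sem ?P"
  obtain N0 where T: "is_tsg T" and N0: "sg_pow_stable (sem T) N0"
    using kr_product_0_stable[OF T0] by blast
  obtain e where e: "is_identity G e" by (rule is_group_identity[OF G(1)])
  then have eG: "e \<in> carrier G" and eg: "\<And>g. g \<in> carrier G \<Longrightarrow> g \<star>\<^bsub>G\<^esub> e = g"
    unfolding is_identity_def by blast+
  have SG: "is_semigroup G" by (rule is_group_semigroup[OF G(1)])
  have tsgQ: "is_tsg ?Q"
    by (rule is_tsg_wreath[OF is_tsg_regular[OF SG] T]) (use eG regular_tsg_points[OF e] in auto)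
  have "points (regular_tsg A) \<noteq> {}" using A(1) by (auto simp: regular_tsg_def is_semigroup_def)
  then have tsgP: "is_tsg ?P" by (rule is_tsg_wreath[OF is_tsg_regular[OF A(1)] tsgQ])
  then have SW: "is_semigroup ?W" by (simp add: is_tsg_def)
  have ST: "is_semigroup (sem T)" using T by (simp add: is_tsg_def)
  have actT: "\<And>q a. q \<in> points T \<Longrightarrow> a \<in> carrier (sem T) \<Longrightarrow> act T q a \<in> points T"
    and multT: "\<And>q a b. q \<in> points T \<Longrightarrow> a \<in> carrier (sem T) \<Longrightarrow> b \<in> carrier (sem T) \<Longrightarrow>
        act T q (a \<star>\<^bsub>sem T\<^esub> b) = act T (act T q a) b"
    using T unfolding is_tsg_def by blast+
  obtain U h where U: "is_subsemigroup U ?W" and hU: "h ` U = carrier S"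
    and hom: "\<forall>v\<in>U. \<forall>w\<in>U. h (v \<star>\<^bsub>?W\<^esub> w) = h v \<star>\<^bsub>S\<^esub> h w"
    using sg_divides_iso[OF SW div iso] unfolding sg_divides_def by (elim exE conjE)
  define WU where "WU = ?W\<lparr>carrier := U\<rparr>"
  have WU: "carrier WU = U" "\<And>v w. v \<star>\<^bsub>WU\<^esub> w = v \<star>\<^bsub>?W\<^esub> w" "is_semigroup WU" "U \<subseteq> carrier ?W"
    using U by (simp_all add: WU_def is_subsemigroup_def)
  define \<pi> where "\<pi> w = snd (snd w)" for w :: "(nat option \<times> nat \<Rightarrow> nat) \<times> (nat \<Rightarrow> nat) \<times> nat"
  define \<gamma> where "\<gamma> w = fst (snd w)" for w :: "(nat option \<times> nat \<Rightarrow> nat) \<times> (nat \<Rightarrow> nat) \<times> nat"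
  have W_mem: "\<pi> w \<in> carrier (sem T)" "\<gamma> w \<in> points T \<rightarrow>\<^sub>E carrier G"
    "fst w \<in> points ?Q \<rightarrow>\<^sub>E carrier A" if "w \<in> U" for w
    using subsetD[OF WU(4) that] by (auto simp: \<pi>_def \<gamma>_def)
  have mem: "\<pi> w \<in> carrier (sem T)" "\<And>q. q \<in> points T \<Longrightarrow> \<gamma> w q \<in> carrier G"
    "\<And>y. y \<in> points ?Q \<Longrightarrow> fst w y \<in> carrier A" if "w \<in> U" for w
    using W_mem[OF that] by (auto simp del: wreath_simps dest: PiE_mem)
  have \<pi>_mult: "\<pi> (v \<star>\<^bsub>WU\<^esub> w) = \<pi> v \<star>\<^bsub>sem T\<^esub> \<pi> w" for v w
    by (simp add: \<pi>_def WU(2) wreath_mult_components)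
  have \<gamma>_mult: "\<gamma> (v \<star>\<^bsub>WU\<^esub> w) q = \<gamma> v q \<star>\<^bsub>G\<^esub> \<gamma> w (act T q (\<pi> v))" if "q \<in> points T" for v w q
    using that by (simp add: \<pi>_def \<gamma>_def WU(2) wreath_mult_components)
  have fst_mult: "fst (v \<star>\<^bsub>WU\<^esub> w) y = fst v y \<star>\<^bsub>A\<^esub> fst w (act ?Q y (snd v))"
    if "y \<in> points ?Q" for v w y
    using that by (simp add: WU(2) wreath_mult_components del: wreath_simps)
  have actQ: "act ?Q (Some g, q) (snd w) = (Some (g \<star>\<^bsub>G\<^esub> \<gamma> w q), act T q (\<pi> w))" for g q w
    by (cases "snd w") (simp add: \<gamma>_def \<pi>_def)
  have pG: "points (regular_tsg G) = Some ` carrier G" by (rule regular_tsg_points[OF e])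
  have homU: "h (v \<star>\<^bsub>WU\<^esub> w) = h v \<star>\<^bsub>S\<^esub> h w" if "v \<in> carrier WU" "w \<in> carrier WU" for v w
    using hom that by (simp add: WU)
  have SS: "is_semigroup S" by (rule semigroup_hom_image[OF WU(3) _ homU]) (simp_all add: WU hU)
  note clU = semigroup_closed[OF WU(3), unfolded WU(1)]
    and powU = sg_pow_closed[OF WU(3), unfolded WU(1)]
  have h_pow: "h (sg_pow WU w n) = sg_pow S (h w) n" if "w \<in> U" for w n
    by (rule sg_pow_hom[OF WU(3) _ homU]) (use that in \<open>simp_all add: WU(1)\<close>)
  have \<pi>_pow: "\<pi> (sg_pow WU w n) = sg_pow (sem T) (\<pi> w) n" if "w \<in> U" for w n
    by (rule sg_pow_hom[OF WU(3) _ \<pi>_mult]) (use that in \<open>simp add: WU(1)\<close>)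

  \<comment> \<open>One exponent for all purposes: past the index of both aperiodic factors, a multiple of the exponent of \<open>G\<close> and of \<open>d\<close>, and at least 2.\<close>
  define l where "l = card (carrier G) * (N0 + card (carrier A) + 2)"
  define m where "m = d * l"
  have cG: "card (carrier G) > 0" using eG G(2) by (auto simp: card_gt_0_iff)
  then have l: "N0 + card (carrier A) + 2 \<le> l" unfolding l_def by (cases "card (carrier G)") auto
  also have "l \<le> m" using d by (simp add: m_def)
  finally have m: "m > 1" "N0 \<le> m" "card (carrier A) \<le> m" by simp_all
  have m_dvd: "d dvd m" "card (carrier G) dvd m" by (simp_all add: m_def l_def)
  have stT: "sg_pow (sem T) a (m + k) = sg_pow (sem T) a m" if "a \<in> carrier (sem T)" for a k
  proof -
    have "sg_pow (sem T) a (Suc m) = sg_pow (sem T) a m"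
      using N0 that m(2) unfolding sg_pow_stable_def by blast
    then show ?thesis using sg_pow_period[OF ST that, of m 1 m k] m(1) by simp
  qed

  obtain x' t' where x': "x' \<in> U" "h x' = x" and t': "t' \<in> U" "h t' = t"
    using x(1) t(1) hU by (metis imageE)
  define X where "X = sg_pow WU x' (Suc m)"
  define Y where "Y = t' \<star>\<^bsub>WU\<^esub> sg_pow WU x' m"
  have XU: "X \<in> U" and YU: "Y \<in> U" unfolding X_def Y_def using x' t' clU powU by blast+
  have hX: "h X = x"
    unfolding X_def h_pow[OF x'(1)] x'(2) m_def
    using sg_pow_period[OF SS x(1), of 1 d 1 l] x(2) by simp
  have "t \<star>\<^bsub>S\<^esub> sg_pow S x (d * n) = t" if "n > 0" for n
    using that
  proof (induction n rule: nat_induct_non_zero)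
    case (Suc n)
    have "t \<star>\<^bsub>S\<^esub> sg_pow S x (d * Suc n) = t \<star>\<^bsub>S\<^esub> (sg_pow S x (d * n) \<star>\<^bsub>S\<^esub> sg_pow S x d)"
      using sg_pow_add[OF SS x(1), of "d * n" d] d Suc by (simp add: add.commute)
    also have "\<dots> = t"
      using Suc t by (simp add: semigroup_assoc[OF SS, symmetric] sg_pow_closed[OF SS x(1)])
    finally show ?case .
  qed (use t in simp)
  then have hY: "h Y = t"
    using l by (simp add: Y_def homU WU(1) x' t' powU h_pow m_def)
  have \<pi>X: "\<pi> Y \<star>\<^bsub>sem T\<^esub> \<pi> X = \<pi> Y"
  proof -
    let ?\<alpha> = "\<pi> x'"
    have a: "?\<alpha> \<in> carrier (sem T)" using mem x' by blast
    note p = sg_pow_closed[OF ST a]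
    have "\<pi> X = sg_pow (sem T) ?\<alpha> m" unfolding X_def \<pi>_pow[OF x'(1)] using stT[OF a, of 1] by simp
    moreover have "\<pi> Y = \<pi> t' \<star>\<^bsub>sem T\<^esub> sg_pow (sem T) ?\<alpha> m" by (simp add: Y_def \<pi>_mult \<pi>_pow x')
    ultimately show ?thesis
      using sg_pow_add[OF ST a, of m m] stT[OF a, of m] m(1)
      by (simp add: semigroup_assoc[OF ST] mem t' p)
  qed
  define c where "c = \<pi> (sg_pow WU Y m)"
  have c: "c = sg_pow (sem T) (\<pi> Y) m" "c \<in> carrier (sem T)"
    using \<pi>_pow[OF YU] mem(1)[OF powU[OF YU]] by (simp_all add: c_def)
  have cY: "c \<star>\<^bsub>sem T\<^esub> \<pi> Y = c" using stT[OF mem(1)[OF YU], of 1] m(1) unfolding c by simp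
  have cX: "c \<star>\<^bsub>sem T\<^esub> \<pi> X = c"
    using cY \<pi>X semigroup_assoc[OF ST c(2) mem(1)[OF YU] mem(1)[OF XU]] by simp

  define M where "M = {w \<in> U. c \<star>\<^bsub>sem T\<^esub> \<pi> w = c}"
  have MU: "w \<in> U" and Mc: "c \<star>\<^bsub>sem T\<^esub> \<pi> w = c" if "w \<in> M" for w
    using that by (simp_all add: M_def)
  have XM: "X \<in> M" and YM: "Y \<in> M" using XU YU cX cY by (simp_all add: M_def)
  have M_mult: "v \<star>\<^bsub>WU\<^esub> w \<in> M" if "v \<in> M" "w \<in> M" for v w
    using that c(2) mem by (simp add: M_def clU \<pi>_mult semigroup_assoc[OF ST, symmetric])
  define MW where "MW = WU\<lparr>carrier := M\<rparr>"
  have MW: "carrier MW = M" "\<And>v w. v \<star>\<^bsub>MW\<^esub> w = v \<star>\<^bsub>WU\<^esub> w" "\<And>w n. sg_pow MW w n = sg_pow WU w n"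
    by (simp_all add: MW_def sg_pow_restrict)
  have SM: "is_semigroup MW"
    unfolding is_semigroup_def MW
    using XM M_mult semigroup_assoc[OF WU(3)] MU WU(1) by auto
  have M_pow: "sg_pow WU w n \<in> M" if "w \<in> M" for w n
    using sg_pow_closed[OF SM] that by (simp add: MW)
  have z: "act T q c \<in> points T" if "q \<in> points T" for q using actT that c(2) .
  have zM: "act T (act T q c) (\<pi> w) = act T q c" if "q \<in> points T" "w \<in> M" for q w
    using multT[OF that(1) c(2) mem(1)[OF MU[OF that(2)]]] Mc[OF that(2)] by simp
  define \<rho> where "\<rho> q w = \<gamma> w (act T q c)" for q w
  have \<rho>: "\<rho> q w \<in> carrier G" if "q \<in> points T" "w \<in> M" for q w
    using that by (simp add: \<rho>_def mem MU z)
  have \<rho>_mult: "\<rho> q (v \<star>\<^bsub>WU\<^esub> w) = \<rho> q v \<star>\<^bsub>G\<^esub> \<rho> q w" if "q \<in> points T" "v \<in> M" for q v w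
    using that by (simp add: \<rho>_def \<gamma>_mult z zM)
  have \<rho>_pow: "\<rho> q (sg_pow WU w n) = sg_pow G (\<rho> q w) n" if "q \<in> points T" "w \<in> M" for q w n
    using sg_pow_hom[where h = "\<rho> q" and R = G, OF SM, of w n] that by (simp add: MW \<rho>_mult)

  define K where "K = {w \<in> M. \<forall>q\<in>points T. \<rho> q w = e}"
  have KM: "K \<subseteq> M" by (auto simp: K_def)
  have ge: "g \<star>\<^bsub>G\<^esub> e = g" "e \<star>\<^bsub>G\<^esub> g = g" if "g \<in> carrier G" for g
    using e that unfolding is_identity_def by blast+
  have gm: "sg_pow G g m = e" if "g \<in> carrier G" for g
    by (rule group_pow_card[OF G e that m_dvd(2)]) (use m in simp)
  have gm': "g \<star>\<^bsub>G\<^esub> sg_pow G g (m - 1) = e" "sg_pow G g (m - 1) \<star>\<^bsub>G\<^esub> g = e"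
    if "g \<in> carrier G" for g
    using sg_pow_add[OF SG that, of 1 "m - 1"] sg_pow_add[OF SG that, of "m - 1" 1] gm[OF that] m
    by simp_all
  have K_mult: "v \<star>\<^bsub>WU\<^esub> w \<in> K" if "v \<in> K" "w \<in> K" for v w
    using that eG by (simp add: K_def M_mult \<rho>_mult ge)
  have K_pow: "sg_pow WU w m \<in> K" if "w \<in> M" for w
    using that by (simp add: K_def M_pow \<rho>_pow gm \<rho>)
  have K_conj: "w \<star>\<^bsub>WU\<^esub> k \<star>\<^bsub>WU\<^esub> sg_pow WU w (m - 1) \<in> K"
      "sg_pow WU w (m - 1) \<star>\<^bsub>WU\<^esub> k \<star>\<^bsub>WU\<^esub> w \<in> K"
      "sg_pow WU (w \<star>\<^bsub>WU\<^esub> k) (m - 1) \<star>\<^bsub>WU\<^esub> w \<in> K" if "w \<in> M" "k \<in> K" for w k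
    using that by (simp_all add: K_def M_mult M_pow \<rho>_mult \<rho>_pow \<rho> ge gm'[unfolded One_nat_def] sg_pow_closed[OF SG])
  have K_final: "sg_pow WU Y m \<star>\<^bsub>WU\<^esub> sg_pow WU k (Suc m) = sg_pow WU Y m \<star>\<^bsub>WU\<^esub> sg_pow WU k m"
    if k: "k \<in> K" for k
  proof -
    let ?u = "sg_pow WU Y m"
    have uU: "?u \<in> U" by (rule powU[OF YU])
    have kn: "sg_pow WU k n \<in> K" for n
      by (induction n) (auto simp: k K_mult)
    have snd_eq: "snd (?u \<star>\<^bsub>WU\<^esub> v) = (\<lambda>q\<in>points T. \<gamma> ?u q \<star>\<^bsub>G\<^esub> e, c)" if v: "v \<in> K" for v
    proof -
      have "\<gamma> v (act T q c) = e" if "q \<in> points T" for q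
        using v that by (simp add: K_def \<rho>_def)
      moreover have "c \<star>\<^bsub>sem T\<^esub> \<pi> v = c" using v Mc KM by blast
      ultimately show ?thesis
        by (intro prod_eqI) (auto simp: WU(2) wreath_mult_components \<gamma>_def[symmetric]
            \<pi>_def[symmetric] c_def[symmetric] fun_eq_iff)
    qed
    have fst_eq: "fst (?u \<star>\<^bsub>WU\<^esub> sg_pow WU k (Suc m)) y = fst (?u \<star>\<^bsub>WU\<^esub> sg_pow WU k m) y"
      if y: "y \<in> points ?Q" for y
    proof -
      obtain g q where gq: "y = (Some g, q)" "g \<in> carrier G" "q \<in> points T"
        using y by (auto simp: pG)
      define y' where "y' = act ?Q y (snd ?u)"
      have y': "y' = (Some (g \<star>\<^bsub>G\<^esub> \<gamma> ?u q), act T q c)"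
        unfolding y'_def gq(1) actQ c_def ..
      have g': "g \<star>\<^bsub>G\<^esub> \<gamma> ?u q \<in> carrier G"
        by (intro semigroup_closed[OF SG] gq mem uU)
      then have y'Q: "y' \<in> points ?Q" unfolding y' using z[OF gq(3)] by (simp add: pG)
      have fix': "act ?Q y' (snd v) = y'" if v: "v \<in> K" for v
        using v gq(3) KM g' unfolding y' actQ
        by (auto simp: zM K_def \<rho>_def ge)
      have "fst (sg_pow WU k n) y' = sg_pow A (fst k y') n" for n
      proof (induction n)
        case (Suc n)
        then show ?case using fst_mult[OF y'Q] fix'[OF kn] by simp
      qed simp
      moreover have "fst k y' \<in> carrier A" using mem(3)[OF _ y'Q] k KM MU by blast
      ultimately have "fst (sg_pow WU k (Suc m)) y' = fst (sg_pow WU k m) y'"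
        using aperiodic_sg_pow_stable[OF A _ m(3)] by (simp del: sg_pow.simps)
      then show ?thesis unfolding fst_mult[OF y] y'_def[symmetric] by simp
    qed
    show ?thesis
    proof (rule prod_eqI)
      show "fst (?u \<star>\<^bsub>WU\<^esub> sg_pow WU k (Suc m)) = fst (?u \<star>\<^bsub>WU\<^esub> sg_pow WU k m)"
      proof (rule PiE_ext)
        show "fst (?u \<star>\<^bsub>WU\<^esub> sg_pow WU k (Suc m)) \<in> points ?Q \<rightarrow>\<^sub>E carrier A"
          "fst (?u \<star>\<^bsub>WU\<^esub> sg_pow WU k m) \<in> points ?Q \<rightarrow>\<^sub>E carrier A"
          using W_mem(3) clU[OF uU] kn KM MU by blast+
      qed (rule fst_eq)
    qed (simp only: snd_eq[OF kn])
  qed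

  have hMU: "h (v \<star>\<^bsub>WU\<^esub> w) = h v \<star>\<^bsub>S\<^esub> h w" if "v \<in> M" "w \<in> M" for v w
    using homU that MU by (simp add: WU(1))
  have hMp: "h (sg_pow WU w n) = sg_pow S (h w) n" if "w \<in> M" for w n
    using h_pow that MU by blast
  note hs = hMU[symmetric] hMp[symmetric] M_mult M_pow KM[THEN subsetD]
  have "identity_related S m (h ` M) (h ` K)"
  proof
    show "h ` M \<subseteq> carrier S" using MU hU by blast
    show "h ` K \<subseteq> h ` M" using KM by blast
  qed (auto simp: hs K_mult K_pow K_conj simp del: One_nat_def)
  moreover have "sg_pow S t m \<star>\<^bsub>S\<^esub> sg_pow S (h k) (Suc m) = sg_pow S t m \<star>\<^bsub>S\<^esub> sg_pow S (h k) m"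
    if k: "k \<in> K" for k
  proof -
    have "sg_pow S t m \<star>\<^bsub>S\<^esub> sg_pow S (h k) n = h (sg_pow WU Y m \<star>\<^bsub>WU\<^esub> sg_pow WU k n)" for n
      using k YM KM by (simp add: hMU hMp M_pow subsetD hY)
    then show ?thesis using K_final[OF k] by metis
  qed
  moreover have "x \<in> h ` M" "t \<in> h ` M" using hX hY XM YM by blast+
  ultimately show ?thesis using m(1) m_dvd(1) by blast
qed

section \<open>Paths with at least six vertices\<close>

definition flip :: "nat \<rightharpoonup> nat" where
  "flip v = (if 1 \<le> v \<and> v \<le> 6 then Some (7 - v) else None)"

text \<open>This map sends the edge \<open>{5, 6}\<close> to the vertex 1, the edge \<open>{2, 3}\<close> to the edge \<open>{5, 6}\<close>, and
  permutes the vertices 1, 3, 5 cyclically. The coincidence of its values at 5 and 6, combined with the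
  reflection \<open>flip\<close>, produces the nontrivial words below.\<close>

definition fold_map :: "nat \<rightharpoonup> nat" where
  "fold_map = [1 \<mapsto> 3, 2 \<mapsto> 6, 3 \<mapsto> 5, 5 \<mapsto> 1, 6 \<mapsto> 1]"

lemma path_simplexI:
  "1 \<le> a \<Longrightarrow> a \<le> n \<Longrightarrow> {a} \<in> simplices (path_graph n)"
  "1 \<le> a \<Longrightarrow> a < n \<Longrightarrow> {a, Suc a} \<in> simplices (path_graph n)"
  by (auto simp: simplices_def path_graph_def)

lemma MR_pathI:
  assumes "dom f \<subseteq> {1..n}" "ran f \<subseteq> {1..n}"
    and fibre: "\<And>i. preimage f {i} \<in> simplices (path_graph n) \<union> {{}}"
    and edge: "\<And>i. preimage f {i, Suc i} \<in> simplices (path_graph n) \<union> {{}}"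
  shows "f \<in> carrier (MR (path_graph n))"
proof -
  have "\<sigma> \<in> simplices (path_graph n) \<Longrightarrow> preimage f \<sigma> \<in> simplices (path_graph n) \<union> {{}}" for \<sigma>
  proof -
    assume "\<sigma> \<in> simplices (path_graph n)"
    then have "(\<exists>i. \<sigma> = {i}) \<or> (\<exists>i. \<sigma> = {i, Suc i})"
      by (auto simp: simplices_def path_graph_def)
    then show ?thesis using fibre edge by blast
  qed
  then show ?thesis using assms by (auto simp: MR_def path_graph_def)
qed

lemma flip_in_MR:
  assumes "6 \<le> n"
  shows "flip \<in> carrier (MR (path_graph n))"
proof (rule MR_pathI)
  have p: "preimage flip {i} = (if 1 \<le> i \<and> i \<le> 6 then {7 - i} else {})" for i
    by (auto simp: preimage_def flip_def split: if_splits)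
  show "preimage flip {i} \<in> simplices (path_graph n) \<union> {{}}" for i
    unfolding p using assms by (auto intro!: path_simplexI)
  show "preimage flip {i, Suc i} \<in> simplices (path_graph n) \<union> {{}}" for i
  proof -
    have "preimage flip {i, Suc i} = preimage flip {i} \<union> preimage flip {Suc i}"
      by (auto simp: preimage_def)
    also have "\<dots> = (if i = 0 then {6} else if i = 6 then {1} else
        if 1 \<le> i \<and> i \<le> 5 then {6 - i, Suc (6 - i)} else {})"
      unfolding p by auto
    also have "\<dots> \<in> simplices (path_graph n) \<union> {{}}"
      using assms by (auto intro!: path_simplexI)
    finally show ?thesis .
  qed
qed (use assms in \<open>auto simp: flip_def ran_def split: if_splits\<close>)

lemma fold_map_in_MR:
  assumes "6 \<le> n"
  shows "fold_map \<in> carrier (MR (path_graph n))"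
proof (rule MR_pathI)
  have p: "preimage fold_map {i} = (if i = 1 then {5, Suc 5} else if i = 3 then {1} else
      if i = 5 then {3} else if i = 6 then {2} else {})" for i
    by (auto simp: preimage_def fold_map_def split: if_splits)
  show "preimage fold_map {i} \<in> simplices (path_graph n) \<union> {{}}" for i
    unfolding p using assms path_simplexI(2)[of 5 n] by (auto intro!: path_simplexI)
  show "preimage fold_map {i, Suc i} \<in> simplices (path_graph n) \<union> {{}}" for i
  proof -
    have "preimage fold_map {i, Suc i} = preimage fold_map {i} \<union> preimage fold_map {Suc i}"
      by (auto simp: preimage_def)
    also have "\<dots> = (if i = 0 \<or> i = 1 then {5, Suc 5} else if i = 2 \<or> i = 3 then {1} else
        if i = 4 then {3} else if i = 5 then {2, Suc 2} else if i = 6 then {2} else {})"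
      unfolding p by auto
    also have "\<dots> \<in> simplices (path_graph n) \<union> {{}}"
      using assms path_simplexI(2)[of 5 n] path_simplexI(2)[of 2 n]
      by (auto intro!: path_simplexI)
    finally show ?thesis .
  qed
qed (use assms in \<open>auto simp: fold_map_def split: if_splits\<close>)

lemma flip_cube: "flip \<circ>\<^sub>m (flip \<circ>\<^sub>m flip) = flip"
  by (rule ext) (auto simp: flip_def map_comp_def)

lemma flip_odd_pow:
  assumes "odd k"
  shows "sg_pow (MR \<Gamma>) flip k = flip"
proof -
  have "sg_pow (MR \<Gamma>) flip (Suc (2 * j)) = flip" for j
    by (induction j) (simp_all add: flip_cube)
  then show ?thesis using assms by (auto elim!: oddE)
qed

lemma sg_pow_2: "sg_pow S f 2 = f \<star>\<^bsub>S\<^esub> f"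
  and sg_pow_3: "sg_pow S f 3 = f \<star>\<^bsub>S\<^esub> f \<star>\<^bsub>S\<^esub> f"
  by (simp_all add: eval_nat_numeral)

lemma pow_fixed: "f a = Some a \<Longrightarrow> sg_pow (MR \<Gamma>) f k a = Some a"
  by (induction k) simp_all

lemma fold_map_values [simp]:
  "fold_map 1 = Some 3" "fold_map (Suc 0) = Some 3" "fold_map 2 = Some 6" "fold_map 3 = Some 5"
  "fold_map 5 = Some 1" "fold_map 6 = Some 1"
  by (simp_all add: fold_map_def)

lemma flip_values [simp]:
  "flip 1 = Some 6" "flip (Suc 0) = Some 6" "flip 2 = Some 5" "flip 5 = Some 2" "flip 6 = Some 1"
  by (simp_all add: flip_def)

text \<open>Words whose value in a group of exponent \<open>m\<close> is trivial act as follows. The power \<open>t\<^sup>m\<close> pulls 6 to 5 and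
  fixes 1. The word \<open>q\<close> is a detour that returns to the same group element and pushes 5 to 6, again fixing 1. With
  a conjugate by the reflection they combine to a word \<open>u\<close> that moves 3 to 5 and fixes 1. The conjugates of \<open>u\<close> by
  the rotation of 1, 3, 5 move either of two tokens to the free one of these three places; three
  such moves, taking tokens at 1 and 3 through \<open>(1, 5)\<close> and \<open>(3, 5)\<close> to \<open>(3, 1)\<close>, interchange them.\<close>

lemma not_divides_kr_product_1:
  assumes n: "6 \<le> n" and kr: "kr_product 1 T"
  shows "\<not> MR (path_graph n) \<prec> sem T"
  supply One_nat_def [simp del]
proof
  let ?S = "MR (path_graph n)"
  assume div: "?S \<prec> sem T"
  note S = is_semigroup_MR[OF is_finite_simple_graph_path_graph, of n]
  note x = flip_in_MR[OF n] and t = fold_map_in_MR[OF n]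
  have x7: "sg_pow ?S flip (Suc 6) = flip" by (rule flip_odd_pow) simp
  have "sg_pow ?S flip 5 = flip" by (rule flip_odd_pow) simp
  then have "sg_pow ?S flip 6 = flip \<circ>\<^sub>m flip" using sg_pow.simps(2)[of ?S flip 5] by simp
  then have t6: "fold_map \<star>\<^bsub>?S\<^esub> sg_pow ?S flip 6 = fold_map"
    by (auto simp: fun_eq_iff map_comp_def fold_map_def flip_def)
  obtain m M K where m: "m > 1" "6 dvd m" and M: "flip \<in> M" "fold_map \<in> M"
    and rel: "identity_related ?S m M K"
    and final: "\<forall>k\<in>K. sg_pow ?S fold_map m \<star>\<^bsub>?S\<^esub> sg_pow ?S k (Suc m)
        = sg_pow ?S fold_map m \<star>\<^bsub>?S\<^esub> sg_pow ?S k m"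
    using complexity_one_obstruction[OF kr div x x7 t t6 zero_less_numeral] by (elim exE conjE)
  interpret identity_related ?S m M K by (rule rel)
  obtain i where i: "m = 6 * i" "i > 0" using m by (auto elim!: dvdE)

  \<comment> \<open>The cube of the rotation, hence the identity on 1, 3, 5; it absorbs 6 into 5.\<close>
  define c where "c = sg_pow ?S fold_map 3"
  have c: "c 1 = Some 1" "c 3 = Some 3" "c 5 = Some 5" "c 6 = Some 5"
    by (simp_all add: c_def sg_pow_3)
  have c_pow: "sg_pow ?S c k 1 = Some 1" "sg_pow ?S c k 3 = Some 3" "sg_pow ?S c k 5 = Some 5" for k
    using c by (simp_all add: pow_fixed)
  have c_pow6: "sg_pow ?S c k 6 = Some 5" for k
    by (induction k) (use c in simp_all)
  have tp: "sg_pow ?S fold_map (3 * k) = sg_pow ?S c k" if "k > 0" for k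
    unfolding c_def using that by (rule sg_pow_mult[OF S t, rotated]) simp
  define w1 where "w1 = sg_pow ?S fold_map m"
  have w1: "w1 1 = Some 1" "w1 3 = Some 3" "w1 5 = Some 5" "w1 6 = Some 5"
    using tp[of "2 * i"] c_pow c_pow6 i by (simp_all add: w1_def)
  \<comment> \<open>The inverse rotation on 1, 3, 5, since 3 divides \<open>m\<close>.\<close>
  define t' where "t' = sg_pow ?S fold_map (m - 1)"
  have "m - 1 = 3 * (2 * i - 1) + 2" using i by simp
  then have "t' = sg_pow ?S c (2 * i - 1) \<star>\<^bsub>?S\<^esub> sg_pow ?S fold_map 2"
    unfolding t'_def using sg_pow_add[OF S t, of "3 * (2 * i - 1)" 2] tp[of "2 * i - 1"] i by simp
  then have t': "t' 1 = Some 5" "t' 3 = Some 1" "t' 5 = Some 3"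
    using c_pow[of "2 * i - 1"] by (simp_all add: sg_pow_2)
  have x': "sg_pow ?S flip (m - 1) = flip" by (rule flip_odd_pow) (use i in simp)

  have w1K: "w1 \<in> K" unfolding w1_def by (rule K_pow[OF M(2)])
  define w2 where "w2 = flip \<star>\<^bsub>?S\<^esub> w1 \<star>\<^bsub>?S\<^esub> sg_pow ?S flip (m - 1)"
  have w2K: "w2 \<in> K" unfolding w2_def by (rule K_conj[OF M(1) w1K])
  have w2: "w2 1 = Some 2" "w2 6 = Some 6" unfolding w2_def x' by (simp_all add: w1)
  define p where "p = flip \<star>\<^bsub>?S\<^esub> fold_map"
  have pM: "p \<in> M" unfolding p_def by (rule M_mult[OF M])
  have p: "p 5 = Some 6" "p 1 = Some 1" by (simp_all add: p_def)
  define q where "q = sg_pow ?S (p \<star>\<^bsub>?S\<^esub> w1) (m - 1) \<star>\<^bsub>?S\<^esub> p"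
  have qK: "q \<in> K" unfolding q_def by (rule K_return[OF pM w1K])
  have "sg_pow ?S (p \<star>\<^bsub>?S\<^esub> w1) (m - 1) 5 = Some 5" "sg_pow ?S (p \<star>\<^bsub>?S\<^esub> w1) (m - 1) 1 = Some 1"
    by (rule pow_fixed, simp add: p w1)+
  then have q: "q 5 = Some 6" "q 1 = Some 1" unfolding q_def by (simp_all add: p)
  define u where "u = (t' \<star>\<^bsub>?S\<^esub> (q \<star>\<^bsub>?S\<^esub> w2) \<star>\<^bsub>?S\<^esub> fold_map) \<star>\<^bsub>?S\<^esub> w1"
  have uK: "u \<in> K" unfolding u_def t'_def by (intro K_mult K_conj' M(2) qK w2K w1K)
  have u: "u 3 = Some 5" "u 1 = Some 1" unfolding u_def by (simp_all add: t' q w2 w1)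
  define v where "v = u \<star>\<^bsub>?S\<^esub> (fold_map \<star>\<^bsub>?S\<^esub> u \<star>\<^bsub>?S\<^esub> t') \<star>\<^bsub>?S\<^esub> (t' \<star>\<^bsub>?S\<^esub> u \<star>\<^bsub>?S\<^esub> fold_map)"
  have vK: "v \<in> K" unfolding v_def t'_def by (rule K_mult[OF K_mult[OF uK K_conj[OF M(2) uK]] K_conj'[OF M(2) uK]])
  have v: "v 1 = Some 3" "v 3 = Some 1" unfolding v_def by (simp_all add: t' u)

  have vS: "v \<in> carrier ?S" using vK K_sub M_sub by blast
  have "sg_pow ?S v m = sg_pow ?S (sg_pow ?S v 2) (3 * i)"
    using sg_pow_mult[OF S vS, of 2 "3 * i"] i by simp
  moreover have "sg_pow ?S v 2 1 = Some 1" by (simp add: v sg_pow_2)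
  ultimately have vm: "sg_pow ?S v m 1 = Some 1" by (simp add: pow_fixed)
  have "(sg_pow ?S fold_map m \<star>\<^bsub>?S\<^esub> sg_pow ?S v m) 1 = Some 1"
    using w1 vm by (simp add: w1_def)
  moreover have "(sg_pow ?S fold_map m \<star>\<^bsub>?S\<^esub> sg_pow ?S v (Suc m)) 1 = Some 3"
    using w1 vm v m by (simp add: w1_def)
  ultimately show False using bspec[OF final vK] by simp
qed

text \<open>In an aperiodic semigroup the powers of a lift of the involution \<open>flip\<close> would be eventually
  constant, but the powers of \<open>flip\<close> alternate between two values.\<close>

lemma not_divides_kr_product_0:
  assumes n: "6 \<le> n" and kr: "kr_product 0 T"
  shows "\<not> MR (path_graph n) \<prec> sem T"
proof
  let ?S = "MR (path_graph n)"
  assume "?S \<prec> sem T"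
  then obtain U h where U: "is_subsemigroup U (sem T)" and hU: "h ` U = carrier ?S"
    and hom: "\<forall>v\<in>U. \<forall>w\<in>U. h (v \<star>\<^bsub>sem T\<^esub> w) = h v \<star>\<^bsub>?S\<^esub> h w"
    unfolding sg_divides_def by (elim exE conjE)
  obtain N where N: "sg_pow_stable (sem T) N" using kr_product_0_stable[OF kr] by blast
  obtain w where w: "w \<in> U" "h w = flip" using hU flip_in_MR[OF n] by (metis imageE)
  have SU: "is_semigroup (sem T\<lparr>carrier := U\<rparr>)" and UT: "U \<subseteq> carrier (sem T)"
    using U by (simp_all add: is_subsemigroup_def)
  have h_pow: "h (sg_pow (sem T) w k) = sg_pow ?S flip k" for k
    using sg_pow_hom[where h = h and R = ?S, OF SU, of w k] w hom by (simp add: sg_pow_restrict)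
  define k where "k = Suc (2 * N)"
  have "sg_pow (sem T) w (Suc k) = sg_pow (sem T) w k"
    using N w UT unfolding sg_pow_stable_def k_def by (auto simp del: sg_pow.simps)
  then have "sg_pow ?S flip (Suc k) = sg_pow ?S flip k" using h_pow by metis
  moreover have "sg_pow ?S flip k = flip" by (rule flip_odd_pow) (simp add: k_def)
  ultimately have "flip \<circ>\<^sub>m flip = flip" by (simp add: k_def)
  then have "(flip \<circ>\<^sub>m flip) 1 = flip 1" by simp
  then show False by simp
qed

theorem theorem17p1: "kr_complexity (MR (path_graph 14)) = 2"
  unfolding kr_complexity_def
proof (rule Least_equality)
  interpret simple_graph "path_graph 14"
    by unfold_locales (rule is_finite_simple_graph_path_graph)
  show "\<exists>T. kr_product 2 T \<and> MR (path_graph 14) \<prec> sem T"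
    by (rule MR_divides_kr_product_2)
next
  fix k assume k: "\<exists>T. kr_product k T \<and> MR (path_graph 14) \<prec> sem T"
  show "2 \<le> k"
  proof (rule ccontr)
    assume "\<not> 2 \<le> k"
    then have "k = 0 \<or> k = 1" by auto
    with k show False
      using not_divides_kr_product_0[of 14] not_divides_kr_product_1[of 14] by auto
  qed
qed

end
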